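(* Let $M$ be a closed nil 3-manifold and $\Gamma=\pi_1(M)$. Then there exists a faithful representation $\varphi\colon\Gamma\to\langle\mathfrak N(3,\mathcal O_k),\iota\rangle$ with $k=\mathbb Q(i)$ or $k=\mathbb Q(\zeta_3)$, where $\zeta_3=-\tfrac12+\tfrac{\sqrt{-3}}2$ and $\mathcal O_k$ is the ring of integers of $k$.
   Context: $\mathfrak N_3=\mathbb C\times\mathbb R$ is the 3-dimensional Heisenberg group with product $(\xi_1,t_1)(\xi_2,t_2)=(\xi_1+\xi_2,t_1+t_2+2\operatorname{Im}(\xi_1\bar\xi_2))$. $\mathrm U(1)$ acts by $U(\xi,t)=(U\xi,t)$, $\mathfrak N(3)=\mathfrak N_3\rtimes\mathrm U(1)$, and $\iota$ is the automorphism induced by complex conjugation, $(\xi,t)\mapsto(\bar\xi,-t)$. For a subring $R\subset\mathbb C$, $\mathfrak N_3(R)=\{(\xi,t)\in\mathfrak N_3:\xi\in R,\ t\in\operatorname{Im}R\}$ where $\operatorname{Im}R=\{\operatorname{Im}z:z\in R\}$, $\mathrm U(1;R)=\mathrm U(1)\cap R$, and $\mathfrak N(3,R)=\mathfrak N_3(R)\rtimes\mathrm U(1;R)$. A closed nil 3-manifold is a compact manifold $\mathfrak N_3/\Gamma$ where $\Gamma$ is a discrete subgroup of $\langle\mathfrak N(3),\iota\rangle$ acting freely on $\mathfrak N_3$. *)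

theory Defs
  imports "HOL-Analysis.Analysis" "HOL-Computational_Algebra.Polynomial" "HOL-Algebra.Group"
begin

definition heis_mul :: "complex \<times> real \<Rightarrow> complex \<times> real \<Rightarrow> complex \<times> real" where
  "heis_mul p q = (fst p + fst q, snd p + snd q + 2 * Im (fst p * cnj (fst q)))"

text \<open>An element (xi, t, u, e) of the group generated by N(3) = N_3 x| U(1) and iota
  stands for the transformation x |-> (xi,t) * U(iota^e(x)) of N_3, where
  iota(z,s) = (cnj z, -s) and U(z,s) = (u z, s); here |u| = 1.\<close>

type_synonym nilisom = "complex \<times> real \<times> complex \<times> bool"

definition cj :: "bool \<Rightarrow> complex \<Rightarrow> complex" where
  "cj e z = (if e then cnj z else z)"

definition sg :: "bool \<Rightarrow> real \<Rightarrow> real" where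
  "sg e s = (if e then - s else s)"

definition nil_act :: "nilisom \<Rightarrow> complex \<times> real \<Rightarrow> complex \<times> real" where
  "nil_act g x = (case g of (xi, t, u, e) \<Rightarrow>
      heis_mul (xi, t) (u * cj e (fst x), sg e (snd x)))"

text \<open>Composition of transformations: nil_act (nil_mult g h) = nil_act g o nil_act h.\<close>

definition nil_mult :: "nilisom \<Rightarrow> nilisom \<Rightarrow> nilisom" where
  "nil_mult g h = (case g of (xi, t, u, e) \<Rightarrow> case h of (eta, s, v, f) \<Rightarrow>
      (fst (nil_act g (eta, s)), snd (nil_act g (eta, s)), u * cj e v, e \<noteq> f))"

definition NilIsom :: "nilisom monoid" where
  "NilIsom = \<lparr>carrier = {g. norm (fst (snd (snd g))) = 1}, mult = nil_mult, one = (0, 0, 1, False)\<rparr>"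

text \<open>For a subring R of C: the group generated by N(3,R) = N_3(R) x| U(1;R) and iota.\<close>

definition NilR :: "complex set \<Rightarrow> nilisom set" where
  "NilR R = {(xi, t, u, e). xi \<in> R \<and> t \<in> Im ` R \<and> u \<in> R \<and> norm u = 1}"

text \<open>Discrete subset (in the Lie group topology, i.e. the product topology on the parameters).\<close>

definition discrete_set :: "nilisom set \<Rightarrow> bool" where
  "discrete_set G \<longleftrightarrow> (\<forall>g\<in>G. \<exists>U. open U \<and> U \<inter> G = {g})"

definition acts_freely :: "nilisom set \<Rightarrow> bool" where
  "acts_freely G \<longleftrightarrow> (\<forall>g\<in>G. \<forall>x. nil_act g x = x \<longrightarrow> g = \<one>\<^bsub>NilIsom\<^esub>)"

definition cocompact :: "nilisom set \<Rightarrow> bool" where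
  "cocompact G \<longleftrightarrow> (\<exists>K. compact K \<and> (\<forall>x. \<exists>g\<in>G. nil_act g x \<in> K))"

definition closed_nil_group :: "nilisom set \<Rightarrow> bool" where
  "closed_nil_group G \<longleftrightarrow> subgroup G NilIsom \<and> discrete_set G \<and> acts_freely G \<and> cocompact G"

definition zeta3 :: complex where
  "zeta3 = Complex (-1/2) (sqrt 3 / 2)"

definition QQi :: "complex set" where
  "QQi = {of_rat a + of_rat b * \<i> | a b. True}"

definition QQzeta3 :: "complex set" where
  "QQzeta3 = {of_rat a + of_rat b * zeta3 | a b. True}"

definition ring_of_integers :: "complex set \<Rightarrow> complex set" where
  "ring_of_integers k = {z \<in> k. algebraic_int z}"

end

theory Submission
  imports Defs
begin

text \<open>
  Project \<open>\<Gamma>\<close> to isometries of the plane. Rotations commute, so commutators of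
  orientation-preserving elements are translations; if some rotation part is nontrivial they
  already form a cobounded set, and otherwise \<open>\<Gamma>\<close> itself provides one. Hence the
  translations occurring in \<open>\<Gamma>\<close> span the plane, their Heisenberg commutators give a
  central element, and with its help discreteness descends to the plane: the translations form
  a lattice, and every rotation part has trace \<open>2 Re u\<close> in the integers.

  Fix independent lattice vectors \<open>a\<close>, \<open>b\<close> and put \<open>\<delta> = Im (a cnj b)\<close>. A
  conjugation makes the lifts of \<open>a\<close> and \<open>b\<close>, and one element reversing the orientation
  of the plane, horizontal. Then all vertical coordinates are rational multiples of \<open>\<delta>\<close> and all plane
  coordinates are rational in the basis \<open>a, b\<close>, with bounded denominators: conjugating the
  lattice controls the plane parts, and twelfth powers of orientation-preserving elements, which
  lie in the Heisenberg group, control the vertical parts. Finally \<open>a, b\<close> can be chosen such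
  that the linear map sending them to \<open>1, w\<close> with \<open>w\<close> equal to the imaginary unit or
  \<open>\<zeta>\<^sub>3\<close> intertwines the point group with units of the ring of integers, and a
  dilation clears the denominators.
\<close>

section \<open>The group of transformations: product, inverse and group laws\<close>

lemma nil_mult_eq:
  "nil_mult (x, t, u, e) (y, s, v, f) =
    (x + u * cj e y, t + sg e s + 2 * Im (x * cnj (u * cj e y)), u * cj e v, e \<noteq> f)"
  by (simp add: nil_mult_def nil_act_def heis_mul_def)

definition nil_inv :: "nilisom \<Rightarrow> nilisom" where
  "nil_inv g = (case g of (x, t, u, e) \<Rightarrow> (- cj e (cnj u * x), - sg e t, cj e (cnj u), e))"

lemma nil_inv_eq: "nil_inv (x, t, u, e) = (- cj e (cnj u * x), - sg e t, cj e (cnj u), e)"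
  by (simp add: nil_inv_def)

lemma norm_cj [simp]: "norm (cj e z) = norm z"
  by (simp add: cj_def)

lemma norm_nil_inv: "norm (fst (snd (snd (nil_inv g)))) = norm (fst (snd (snd g)))"
  by (cases g) (simp add: nil_inv_eq)

lemma unit_mult_cnj:
  assumes "norm u = 1" shows "u * cnj u = 1" "cnj u * u = 1"
  using assms complex_norm_square[of u] by (simp_all add: mult.commute)

lemma nil_mult_inv:
  assumes "norm (fst (snd (snd g))) = 1"
  shows "nil_mult (nil_inv g) g = (0, 0, 1, False)"
proof -
  obtain x t u e where g: "g = (x, t, u, e)" by (cases g)
  have u: "u * cnj u = 1" "cnj u * u = 1" using assms g unit_mult_cnj by auto
  have "Im (x * u * (cnj u * cnj x)) = 0"
    by (metis (no_types, opaque_lifting) complex_cnj_mult complex_In_mult_cnj_zero mult.assoc mult.commute)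
  then show ?thesis using u
    by (cases e) (auto simp: g nil_inv_eq nil_mult_eq cj_def sg_def mult_ac)
qed

text \<open>A rotation by a unit \<open>u\<close> preserves the form \<open>Im (y * cnj q)\<close>
  and conjugation negates it, exactly as \<open>sg\<close> negates the vertical coordinate; hence
  the Heisenberg cocycle is compatible with the point parts.\<close>

lemma nil_mult_assoc: "nil_mult (nil_mult g h) k = nil_mult g (nil_mult h k)" if "norm (fst (snd (snd g))) = 1"
proof -
  obtain x t u e where g: "g = (x, t, u, e)" by (cases g)
  obtain y s v f where h: "h = (y, s, v, f)" by (cases h)
  obtain z r w i where k: "k = (z, r, w, i)" by (cases k)
  have u: "u * (cnj u * q) = q" for q using that g unit_mult_cnj[of u]
    by (simp add: mult.assoc[symmetric])
  have "Im (u * cj e y * cnj (u * cj e q)) = sg e (Im (y * cnj q))" for q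
  proof -
    have "u * cj e y * cnj (u * cj e q) = u * (cnj u * (cj e y * cnj (cj e q)))"
      by (simp only: complex_cnj_mult mult_ac)
    then show ?thesis by (simp only: u) (simp add: cj_def sg_def)
  qed
  note * = this[of "v * cj f z"]
  have c: "cj e (v * cj f q) = cj e v * cj (e \<noteq> f) q" for q by (simp add: cj_def)
  show ?thesis using * unfolding g h k nil_mult_eq c
    by (auto simp: nil_mult_eq algebra_simps cj_def sg_def)
qed

lemma group_NilIsom: "group NilIsom"
proof (rule groupI)
  fix g assume "g \<in> carrier NilIsom"
  then show "\<exists>h\<in>carrier NilIsom. h \<otimes>\<^bsub>NilIsom\<^esub> g = \<one>\<^bsub>NilIsom\<^esub>"
    by (intro bexI[of _ "nil_inv g"]) (simp_all add: NilIsom_def nil_mult_inv norm_nil_inv)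
qed (auto simp: NilIsom_def nil_mult_assoc, auto simp: nil_mult_eq norm_mult cj_def sg_def)

lemma inv_NilIsom:
  assumes "g \<in> carrier NilIsom" shows "inv\<^bsub>NilIsom\<^esub> g = nil_inv g"
  by (rule group.inv_equality[OF group_NilIsom])
     (use assms in \<open>simp_all add: NilIsom_def nil_mult_inv norm_nil_inv\<close>)

section \<open>Integral combinations in the plane and on the vertical line\<close>

definition int_span :: "complex \<Rightarrow> complex \<Rightarrow> complex set" where
  "int_span a b = {of_int m * a + of_int n * b | m n. True}"

lemma int_spanI: "z = of_int m * a + of_int n * b \<Longrightarrow> z \<in> int_span a b"
  by (auto simp: int_span_def)

lemma int_span_diff:
  assumes "x \<in> int_span a b" "y \<in> int_span a b" shows "x - y \<in> int_span a b"
proof -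
  obtain m n m' n' where "x = of_int m * a + of_int n * b" "y = of_int m' * a + of_int n' * b"
    using assms by (auto simp: int_span_def)
  then show ?thesis
    by (intro int_spanI[of _ "m - m'" _ "n - n'"]) (simp add: algebra_simps)
qed

lemma int_span_mult:
  assumes "x \<in> int_span a b" shows "of_int k * x \<in> int_span a b"
proof -
  obtain m n where "x = of_int m * a + of_int n * b"
    using assms by (auto simp: int_span_def)
  then show ?thesis
    by (intro int_spanI[of _ "k * m" _ "k * n"]) (simp add: algebra_simps)
qed

text \<open>Cramer's rule, with \<open>Im (a * cnj b)\<close> in the role of the
  determinant.\<close>

lemma plane_coordinates:
  assumes "Im (a * cnj b) \<noteq> 0"
  shows "z = of_real (Im (z * cnj b) / Im (a * cnj b)) * a + of_real (Im (a * cnj z) / Im (a * cnj b)) * b"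
proof -
  have "of_real (Im (a * cnj b)) * z = of_real (Im (z * cnj b)) * a + of_real (Im (a * cnj z)) * b"
    by (simp add: complex_eq_iff algebra_simps)
  then have "z = (of_real (Im (z * cnj b)) * a + of_real (Im (a * cnj z)) * b) / of_real (Im (a * cnj b))"
    using assms by (metis nonzero_mult_div_cancel_left of_real_eq_0_iff)
  then show ?thesis by (simp only: of_real_divide times_divide_eq_left add_divide_distrib)
qed

lemma Im_int_span:
  assumes "x \<in> int_span a b" "y \<in> int_span a b"
  shows "\<exists>k. Im (x * cnj y) = of_int k * Im (a * cnj b)"
proof -
  obtain m n m' n' where "x = of_int m * a + of_int n * b" "y = of_int m' * a + of_int n' * b"
    using assms by (auto simp: int_span_def)
  then show ?thesis
    by (intro exI[of _ "m * n' - n * m'"]) (simp add: algebra_simps)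
qed

definition int_multiples :: "real \<Rightarrow> real set" where
  "int_multiples d = {of_int k * d | k. True}"

lemma int_multiplesI: "r = of_int k * d \<Longrightarrow> r \<in> int_multiples d"
  by (auto simp: int_multiples_def)

lemma int_multiples_add: "r \<in> int_multiples d \<Longrightarrow> s \<in> int_multiples d \<Longrightarrow> r + s \<in> int_multiples d"
  by (auto simp: int_multiples_def simp flip: distrib_right of_int_add)

lemma int_multiples_diff: "r \<in> int_multiples d \<Longrightarrow> s \<in> int_multiples d \<Longrightarrow> r - s \<in> int_multiples d"
  by (auto simp: int_multiples_def simp flip: left_diff_distrib of_int_diff)

lemma int_multiples_mult: "r \<in> int_multiples d \<Longrightarrow> of_int k * r \<in> int_multiples d"
  by (auto simp: int_multiples_def mult.assoc[symmetric] simp flip: of_int_mult)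

lemma Im_complex_of_real_mult: "Im (of_real r * z) = r * Im z"
  by simp

lemma floor_remainder_le:
  fixes c s :: real
  assumes "c \<noteq> 0" shows "\<bar>s - \<lfloor>s / c\<rfloor> * c\<bar> \<le> \<bar>c\<bar>"
proof -
  have "s - \<lfloor>s / c\<rfloor> * c = frac (s / c) * c" using assms by (simp add: frac_def left_diff_distrib)
  then show ?thesis using frac_lt_1[of "s / c"] by (simp add: abs_mult mult_left_le_one_le)
qed

text \<open>Pigeonhole: among the multiples \<open>0, ..., card F\<close> of \<open>h\<close>, two
  leave the same remainder in \<open>F\<close>, so some positive multiple of \<open>h\<close> by at
  most \<open>card F\<close> lies in \<open>M\<close>. The factorial is divisible by all these
  multipliers and hence serves every \<open>h\<close> at once.\<close>

lemma multiple_in_subgroup: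
  fixes H M :: "'a :: comm_ring_1 set"
  assumes "finite F"
    and F: "\<And>h. h \<in> H \<Longrightarrow> \<exists>m\<in>M. h - m \<in> F"
    and H: "\<And>h j. h \<in> H \<Longrightarrow> of_int j * h \<in> H"
    and M: "\<And>m j. m \<in> M \<Longrightarrow> of_int j * m \<in> M" "\<And>x y. x \<in> M \<Longrightarrow> y \<in> M \<Longrightarrow> x - y \<in> M"
  obtains N :: nat where "N > 0" "\<And>h. h \<in> H \<Longrightarrow> of_nat N * h \<in> M"
proof (rule that[of "fact (card F)"])
  fix h assume h: "h \<in> H"
  have "\<exists>m\<in>M. of_nat j * h - m \<in> F" for j :: nat using F[OF H[OF h, of "int j"]] by simp
  then obtain r where r: "\<And>j. r j \<in> M" "\<And>j. of_nat j * h - r j \<in> F" by metis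
  let ?f = "\<lambda>j. of_nat j * h - r j"
  have "\<not> inj_on ?f {..card F}"
  proof
    assume "inj_on ?f {..card F}"
    from card_inj_on_le[OF this _ \<open>finite F\<close>] r(2) show False by auto
  qed
  then obtain i j where ij: "i < j" "j \<le> card F" "?f i = ?f j"
    unfolding inj_on_def by (metis atMost_iff linorder_neqE_nat)
  then have "of_nat (j - i) * h = r j - r i"
    by (simp add: of_nat_diff algebra_simps)
  then have mem: "of_nat (j - i) * h \<in> M" using M(2) r(1) by simp
  have "j - i dvd fact (card F)" using ij by (intro dvd_fact) auto
  then obtain c where "fact (card F) = (j - i) * c" by (auto simp: dvd_def)
  then have "of_nat (fact (card F)) * h = of_int (int c) * (of_nat (j - i) * h)"
    by (simp add: mult_ac)
  then show "of_nat (fact (card F)) * h \<in> M" using M(1)[OF mem, of "int c"] by simp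
qed simp

section \<open>Subgroups, their Heisenberg part and its projection to the plane\<close>

locale nil_subgroup =
  fixes G :: "nilisom set"
  assumes subgroup: "subgroup G NilIsom"
begin

lemma unit: "(x, t, u, e) \<in> G \<Longrightarrow> norm u = 1"
  using subgroup.subset[OF subgroup] by (auto simp: NilIsom_def)

lemma mult: "(x, t, u, e) \<in> G \<Longrightarrow> (y, s, v, f) \<in> G \<Longrightarrow>
   (x + u * cj e y, t + sg e s + 2 * Im (x * cnj (u * cj e y)), u * cj e v, e \<noteq> f) \<in> G"
  using subgroup.m_closed[OF subgroup, of "(x, t, u, e)" "(y, s, v, f)"]
  by (simp add: NilIsom_def nil_mult_eq)

lemma inverse: "(x, t, u, e) \<in> G \<Longrightarrow> (- cj e (cnj u * x), - sg e t, cj e (cnj u), e) \<in> G"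
  using subgroup.m_inv_closed[OF subgroup, of "(x, t, u, e)"] subgroup.subset[OF subgroup]
  by (simp add: inv_NilIsom nil_inv_eq subset_iff)

lemma one: "(0, 0, 1, False) \<in> G"
  using subgroup.one_closed[OF subgroup] by (simp add: NilIsom_def)

text \<open>This is the kernel of the map to the point part \<open>(u, e)\<close>, hence a normal
  subgroup.\<close>

definition nil_part :: "(complex \<times> real) set" where
  "nil_part = {(l, s). (l, s, 1, False) \<in> G}"

definition transl :: "complex set" where
  "transl = {l. \<exists>s. (l, s) \<in> nil_part}"

lemma nil_part_iff: "(l, s) \<in> nil_part \<longleftrightarrow> (l, s, 1, False) \<in> G" by (simp add: nil_part_def)

lemma nil_part_mult: "(l, s) \<in> nil_part \<Longrightarrow> (m, r) \<in> nil_part \<Longrightarrow> (l + m, s + r + 2 * Im (l * cnj m)) \<in> nil_part"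
  using mult[of l s 1 False m r 1 False] by (simp add: nil_part_iff cj_def sg_def)

lemma nil_part_inv: "(l, s) \<in> nil_part \<Longrightarrow> (- l, - s) \<in> nil_part"
  using inverse[of l s 1 False] by (simp add: nil_part_iff cj_def sg_def)

text \<open>The cocycle vanishes on a vector and its real multiples, so powers are computed
  coordinatewise.\<close>

lemma nil_part_power:
  assumes "(l, s) \<in> nil_part" shows "(of_int n * l, of_int n * s) \<in> nil_part"
proof -
  have nat: "(of_nat k * l, of_nat k * s) \<in> nil_part" for k :: nat
  proof (induction k)
    case (Suc k)
    have "Im (l * cnj (of_nat k * l)) = 0" by simp
    with nil_part_mult[OF assms Suc] show ?case by (simp add: algebra_simps)
  qed (use one in \<open>simp add: nil_part_iff\<close>)
  show ?thesis
  proof (cases n)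
    case (neg k)
    show ?thesis unfolding neg using nil_part_inv[OF nat[of "Suc k"]] by (simp add: algebra_simps)
  qed (use nat in simp)
qed

text \<open>The cocycle enters once from each side of the conjugation, whence the factor 4. The
  shift of the vertical coordinate later measures \<open>x\<close> against lattice vectors.\<close>

lemma nil_part_conj:
  assumes "(x, t, u, e) \<in> G" "(l, s) \<in> nil_part"
  shows "(u * cj e l, sg e s + 4 * Im (x * cnj (u * cj e l))) \<in> nil_part"
proof -
  have u: "u * cnj u = 1" "u * (cnj u * q) = q" "u * (q * cnj u) = q" for q
    using unit[OF assms(1)] unit_mult_cnj[of u]
    by (auto simp: mult.assoc[symmetric] mult.left_commute[of u q])
  from mult[OF mult[OF assms(1) assms(2)[unfolded nil_part_iff]] inverse[OF assms(1)]]
  show ?thesis by (cases e) (auto simp: nil_part_iff cj_def sg_def u algebra_simps)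
qed

lemma transl_add: "l \<in> transl \<Longrightarrow> m \<in> transl \<Longrightarrow> l + m \<in> transl"
  unfolding transl_def using nil_part_mult by blast

lemma transl_int: "l \<in> transl \<Longrightarrow> of_int n * l \<in> transl"
  using nil_part_power by (auto simp: transl_def)

lemma transl_rot: "(x, t, u, e) \<in> G \<Longrightarrow> l \<in> transl \<Longrightarrow> u * cj e l \<in> transl"
  unfolding transl_def using nil_part_conj by blast

lemma nil_part_commutator:
  assumes "(l, s) \<in> nil_part" "(m, r) \<in> nil_part" shows "(0, 4 * Im (l * cnj m)) \<in> nil_part"
  using nil_part_mult[OF nil_part_mult[OF assms] nil_part_mult[OF nil_part_inv[OF assms(1)] nil_part_inv[OF assms(2)]]]
  by (simp add: algebra_simps)

text \<open>In the commutator of the two elements the commuting rotation parts cancel. Only its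
  plane component matters here; the vertical one is left as an unspecified \<open>q\<close>.\<close>

lemma transl_commutator:
  assumes "(x, t, u, False) \<in> G" "(y, s, v, False) \<in> G"
  shows "(1 - v) * x - (1 - u) * y \<in> transl"
proof -
  have u: "u * cnj u = 1" "u * (cnj u * q) = q" "v * cnj v = 1" "v * (cnj v * q) = q" for q
    using unit[OF assms(1)] unit[OF assms(2)] unit_mult_cnj[of u] unit_mult_cnj[of v]
    by (auto simp: mult.assoc[symmetric])
  note mult[OF mult[OF assms] inverse[OF mult[OF assms(2,1)]]]
  then obtain q where "(x + u * y + u * v * (- (cnj (v * u) * (y + v * x))), q, u * v * cnj (v * u), False) \<in> G"
    by (auto simp: cj_def)
  moreover have "u * v * cnj (v * u) = 1"
    by (simp add: mult_ac u)
  moreover have "x + u * y + u * v * (- (cnj (v * u) * (y + v * x))) = (1 - v) * x - (1 - u) * y"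
    using calculation(2) by (simp add: algebra_simps u)
  ultimately show ?thesis by (auto simp: transl_def nil_part_iff)
qed

section \<open>Consequences of cocompactness for the plane\<close>

text \<open>If an element moves \<open>(z, 0)\<close> into the compact set, then its inverse has a
  plane component near \<open>z\<close>. Should that inverse reverse the plane, multiplying it by
  one fixed reversing element \<open>h\<close> repairs this and enlarges the distance by at most
  \<open>norm y\<close>.\<close>

lemma cobounded:
  assumes "cocompact G"
  obtains R where "R \<ge> 0" "\<And>z. \<exists>x t u. (x, t, u, False) \<in> G \<and> norm (x - z) \<le> R"
proof -
  from assms obtain K where K: "compact K" "\<And>x. \<exists>g\<in>G. nil_act g x \<in> K"
    unfolding cocompact_def by blast
  from compact_imp_bounded[OF K(1)] obtain B where B: "\<And>p. p \<in> K \<Longrightarrow> norm p \<le> B"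
    unfolding bounded_iff by blast
  have near: "\<exists>x t u e. (x, t, u, e) \<in> G \<and> norm (x - z) \<le> B" for z
  proof -
    obtain y s v f where g: "(y, s, v, f) \<in> G" "nil_act (y, s, v, f) (z, 0) \<in> K"
      using K(2)[of "(z, 0)"] by (metis prod_cases4)
    let ?w = "y + v * cj f z"
    have "norm ?w \<le> B"
      using norm_fst_le[of ?w] B[OF g(2)] by (fastforce simp: nil_act_def heis_mul_def intro: order_trans)
    moreover have "cj f (cnj v * ?w) = cj f (cnj v * y) + cj f (cnj v * v) * z"
      by (simp add: cj_def algebra_simps)
    then have "cj f (cnj v * y) + z = cj f (cnj v * ?w)"
      using unit_mult_cnj(2)[OF unit[OF g(1)]] by (simp add: cj_def)
    then have "norm (- cj f (cnj v * y) - z) = norm (cnj v * ?w)"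
      by (metis minus_add_distrib norm_cj norm_minus_cancel uminus_add_conv_diff diff_conv_add_uminus)
    ultimately have "norm (- cj f (cnj v * y) - z) \<le> B" using unit[OF g(1)] by (simp add: norm_mult)
    with inverse[OF g(1)] show ?thesis by blast
  qed
  have B0: "B \<ge> 0" using near[of 0] norm_ge_zero order_trans by blast
  show ?thesis
  proof (cases "\<exists>y s v. (y, s, v, True) \<in> G")
    case False
    show ?thesis
    proof (rule that[OF B0])
      fix z from near[of z] False show "\<exists>x t u. (x, t, u, False) \<in> G \<and> norm (x - z) \<le> B"
        by (metis (full_types))
    qed
  next
    case True
    then obtain y s v where h: "(y, s, v, True) \<in> G" by blast
    show ?thesis
    proof (rule that[of "B + norm y"])
      fix z
      obtain x t u e where g: "(x, t, u, e) \<in> G" "norm (x - z) \<le> B" using near by blast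
      show "\<exists>x t u. (x, t, u, False) \<in> G \<and> norm (x - z) \<le> B + norm y"
      proof (cases e)
        case True
        have "norm (x + u * cnj y - z) \<le> norm (x - z) + norm (u * cnj y)"
          using norm_triangle_ineq[of "x - z" "u * cnj y"] by (simp add: algebra_simps)
        then have "norm (x + u * cnj y - z) \<le> B + norm y"
          using g unit[OF g(1)] by (simp add: norm_mult)
        then show ?thesis using mult[OF g(1) h] True by (auto simp: cj_def)
      next
        case False
        then show ?thesis using g norm_ge_zero[of y] by (metis add_increasing2)
      qed
    qed (use B0 in simp)
  qed
qed

text \<open>Without rotations the orientation-preserving elements are already translations.
  Otherwise commutators with a fixed \<open>h\<close> whose rotation is \<open>v\<close> are used:
  choosing \<open>x\<close> near \<open>z / (1 - v)\<close> puts \<open>(1 - v) * x\<close> near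
  \<open>z\<close>, and the other term has norm at most \<open>2 * norm y\<close>.\<close>

lemma transl_cobounded:
  assumes "cocompact G"
  obtains R where "\<And>z. \<exists>l\<in>transl. norm (l - z) \<le> R"
proof -
  obtain R where R: "R \<ge> 0" "\<And>z. \<exists>x t u. (x, t, u, False) \<in> G \<and> norm (x - z) \<le> R"
    using cobounded[OF assms] by blast
  show ?thesis
  proof (cases "\<exists>y s v. (y, s, v, False) \<in> G \<and> v \<noteq> 1")
    case False
    show ?thesis
      by (rule that[of R]) (use R(2) False in \<open>fastforce simp: transl_def nil_part_iff\<close>)
  next
    case True
    then obtain y s v where h: "(y, s, v, False) \<in> G" "v \<noteq> 1" by blast
    show ?thesis
    proof (rule that[of "norm (1 - v) * R + 2 * norm y"])
      fix z
      obtain x t u where g: "(x, t, u, False) \<in> G" "norm (x - z / (1 - v)) \<le> R" using R(2) by blast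
      have "norm ((1 - v) * x - (1 - u) * y - z) = norm ((1 - v) * (x - z / (1 - v)) - (1 - u) * y)"
        using h(2) by (simp add: right_diff_distrib[of "1 - v"] diff_diff_eq add.commute[of z])
      also have "\<dots> \<le> norm ((1 - v) * (x - z / (1 - v))) + norm ((1 - u) * y)"
        by (rule norm_triangle_ineq4)
      also have "\<dots> \<le> norm (1 - v) * R + 2 * norm y"
        using g(2) norm_triangle_ineq4[of 1 u] unit[OF g(1)]
        by (intro add_mono) (auto simp: norm_mult intro!: mult_left_mono mult_right_mono)
      finally show "\<exists>l\<in>transl. norm (l - z) \<le> norm (1 - v) * R + 2 * norm y"
        using transl_commutator[OF g(1) h(1)] by blast
    qed
  qed
qed

lemma transl_spans:
  assumes "cocompact G"
  obtains a b where "a \<in> transl" "b \<in> transl" "Im (a * cnj b) \<noteq> 0"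
proof -
  obtain R where R: "\<And>z. \<exists>l\<in>transl. norm (l - z) \<le> R" using transl_cobounded[OF assms] by blast
  \<comment> \<open>Elements near \<open>T\<close> and \<open>T * \<i>\<close> then have diagonal
    entries at least \<open>2 * R + 1\<close> and off-diagonal entries at most \<open>R\<close>, so
    the determinant cannot vanish.\<close>
  define T where "T = 3 * R + 1"
  obtain a b where ab: "a \<in> transl" "b \<in> transl" "norm (a - of_real T) \<le> R" "norm (b - of_real T * \<i>) \<le> R"
    using R by metis
  have "\<bar>Im a\<bar> \<le> R" "\<bar>Re b\<bar> \<le> R" "Re a \<ge> 2 * R + 1" "Im b \<ge> 2 * R + 1"
    using abs_Re_le_cmod[of "a - of_real T"] abs_Im_le_cmod[of "a - of_real T"]
      abs_Re_le_cmod[of "b - of_real T * \<i>"] abs_Im_le_cmod[of "b - of_real T * \<i>"] ab(3,4)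
    by (auto simp: T_def)
  then have "\<bar>Im a * Re b\<bar> \<le> R * R" "(2 * R + 1) * (2 * R + 1) \<le> Re a * Im b" "R \<ge> 0"
    by (auto simp: abs_mult intro!: mult_mono)
  moreover have "R * R < (2 * R + 1) * (2 * R + 1)" using \<open>R \<ge> 0\<close> by (intro mult_strict_mono) auto
  ultimately have "Im (a * cnj b) \<noteq> 0" by simp
  with ab(1,2) show ?thesis by (rule that)
qed

section \<open>Discreteness of the Heisenberg part\<close>

lemma nil_part_isolated:
  assumes "discrete_set G"
  obtains \<epsilon> where "\<epsilon> > 0" "\<And>p. p \<in> nil_part \<Longrightarrow> norm p < \<epsilon> \<Longrightarrow> p = 0"
proof -
  obtain U where U: "open U" "U \<inter> G = {(0, 0, 1, False)}"
    using assms one unfolding discrete_set_def by blast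
  define f where "f p = (fst p, snd p, 1 :: complex, False)" for p :: "complex \<times> real"
  have "open (f -` U)" unfolding f_def
    by (intro open_vimage U continuous_intros)
  moreover have "0 \<in> f -` U" using U(2) by (auto simp: f_def)
  ultimately obtain \<epsilon> where \<epsilon>: "\<epsilon> > 0" "ball 0 \<epsilon> \<subseteq> f -` U" by (meson openE)
  show ?thesis
  proof (rule that[OF \<epsilon>(1)])
    fix p assume "p \<in> nil_part" "norm p < \<epsilon>"
    then have "f p \<in> U \<inter> G" using \<epsilon>(2) by (auto simp: f_def nil_part_def subset_iff)
    then show "p = 0" using U(2) by (auto simp: f_def prod_eq_iff)
  qed
qed

text \<open>At an accumulation point there would be distinct elements \<open>p\<close>,
  \<open>q\<close> so close that the quotient of \<open>q\<close> by \<open>p\<close> lies in the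
  neighbourhood isolating the identity. The cocycle distorts this quotient only by an amount
  controlled by \<open>B\<close>.\<close>

lemma nil_part_finite:
  assumes "discrete_set G"
  shows "finite (nil_part \<inter> cball 0 B)"
proof (rule ccontr)
  assume "infinite (nil_part \<inter> cball 0 B)"
  then obtain c where c: "c islimpt (nil_part \<inter> cball 0 B)"
    using bounded_infinite_imp_islimpt[of "nil_part \<inter> cball 0 B" "nil_part \<inter> cball 0 B"]
    by (metis bounded_Int bounded_cball order_refl)
  obtain \<epsilon> where \<epsilon>: "\<epsilon> > 0" "\<And>p. p \<in> nil_part \<Longrightarrow> norm p < \<epsilon> \<Longrightarrow> p = 0"
    using nil_part_isolated[OF assms] by blast
  \<comment> \<open>The gap \<open>2 * r\<close> between two points of the ball and the cocycle
    error \<open>4 * \<bar>B\<bar> * r\<close> together must stay below \<open>\<epsilon>\<close>;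
    the \<open>2 +\<close> keeps the denominator positive.\<close>
  define r where "r = \<epsilon> / (4 * (2 + \<bar>B\<bar>))"
  have r: "r > 0" using \<epsilon>(1) by (simp add: r_def add_pos_nonneg)
  have inf: "infinite (nil_part \<inter> cball 0 B \<inter> ball c r)" using c r unfolding islimpt_eq_infinite_ball by blast
  then obtain p where p: "p \<in> nil_part \<inter> cball 0 B \<inter> ball c r"
    using infinite_imp_nonempty by blast
  from inf have "infinite (nil_part \<inter> cball 0 B \<inter> ball c r - {p})" by simp
  then obtain q where q: "q \<in> nil_part \<inter> cball 0 B \<inter> ball c r" "q \<noteq> p"
    using infinite_imp_nonempty by blast
  obtain l s m k where pq: "p = (l, s)" "q = (m, k)" by (cases p, cases q)
  have d: "norm (q - p) < 2 * r" using p q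
    by (smt (verit) Int_iff dist_commute dist_norm dist_triangle mem_ball)
  have "(- l + m, - s + k + 2 * Im (- l * cnj m)) \<in> nil_part"
    using nil_part_mult[OF nil_part_inv] p q pq by blast
  \<comment> \<open>Since \<open>Im (l * cnj l) = 0\<close>, \<open>m\<close> may be replaced by the
    small difference \<open>m - l\<close>.\<close>
  moreover have "Im (- l * cnj m) = - Im (l * cnj (m - l))" by (simp add: algebra_simps)
  ultimately have mem: "(q - p) + (0, - 2 * Im (l * cnj (m - l))) \<in> nil_part"
    by (simp add: pq algebra_simps)
  have l: "norm l \<le> \<bar>B\<bar>" using p norm_fst_le[of l s] by (auto simp: pq)
  have ml: "norm (m - l) \<le> 2 * r" using d norm_fst_le[of "m - l" "k - s"] by (simp add: pq)
  have "\<bar>Im (l * cnj (m - l))\<bar> \<le> norm l * norm (m - l)"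
    by (metis abs_Im_le_cmod complex_mod_cnj norm_mult)
  also have "\<dots> \<le> \<bar>B\<bar> * (2 * r)" using l ml by (intro mult_mono) auto
  finally have "norm (0 :: complex, - 2 * Im (l * cnj (m - l))) \<le> 2 * (\<bar>B\<bar> * (2 * r))"
    by (simp add: norm_Pair abs_mult)
  with d have "norm ((q - p) + (0, - 2 * Im (l * cnj (m - l)))) < 2 * r + 2 * (\<bar>B\<bar> * (2 * r))"
    by (smt (verit) norm_triangle_ineq)
  also have "\<dots> \<le> 4 * (2 + \<bar>B\<bar>) * r" using r by (simp add: algebra_simps)
  also have "\<dots> = \<epsilon>" by (simp add: r_def)
  finally have "(q - p) + (0, - 2 * Im (l * cnj (m - l))) = 0" using \<epsilon>(2)[OF mem] by blast
  then have "p = q" by (auto simp: pq prod_eq_iff)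
  with q(2) show False by simp
qed

section \<open>The translation lattice, the centre and the crystallographic restriction\<close>

lemma transl_diff: "l \<in> transl \<Longrightarrow> m \<in> transl \<Longrightarrow> l - m \<in> transl"
  using transl_add[OF _ transl_int[of m "-1"]] by simp

lemma int_span_subset_transl:
  assumes "a \<in> transl" "b \<in> transl" shows "int_span a b \<subseteq> transl"
  using assms by (auto simp: int_span_def intro!: transl_add transl_int)

text \<open>A commutator of two independent translations is a nontrivial central element
  \<open>(0, c)\<close>. Its powers bring the vertical coordinate of any lift below
  \<open>\<bar>c\<bar>\<close>, so bounded translations have bounded lifts, of which there are
  finitely many.\<close>

lemma transl_finite:
  assumes "discrete_set G" "cocompact G"
  shows "finite (transl \<inter> cball 0 B)"
proof -
  obtain a b where ab: "a \<in> transl" "b \<in> transl" "Im (a * cnj b) \<noteq> 0" using transl_spans[OF assms(2)] by blast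
  define c where "c = 4 * Im (a * cnj b)"
  have c: "(0, c) \<in> nil_part" "c \<noteq> 0" using ab nil_part_commutator by (auto simp: transl_def c_def)
  have "transl \<inter> cball 0 B \<subseteq> fst ` (nil_part \<inter> cball 0 (B + \<bar>c\<bar>))"
  proof
    fix l assume l: "l \<in> transl \<inter> cball 0 B"
    then obtain s where s: "(l, s) \<in> nil_part" by (auto simp: transl_def)
    define k where "k = \<lfloor>s / c\<rfloor>"
    have "(l, s - k * c) \<in> nil_part"
      using nil_part_mult[OF s nil_part_power[OF c(1), of "- k"]] by simp
    moreover have "\<bar>s - k * c\<bar> \<le> \<bar>c\<bar>"
      unfolding k_def by (rule floor_remainder_le[OF c(2)])
    then have "norm (l, s - k * c) \<le> B + \<bar>c\<bar>"
      using l norm_Pair_le[of l "s - k * c"] by simp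
    ultimately show "l \<in> fst ` (nil_part \<inter> cball 0 (B + \<bar>c\<bar>))" by force
  qed
  then show ?thesis using nil_part_finite[OF assms(1)] finite_surj by blast
qed

text \<open>Taking off the integer parts of the coordinates with respect to \<open>a\<close>,
  \<open>b\<close> leaves a translation in a fixed ball, hence in a finite set, and the pigeonhole
  lemma applies.\<close>

lemma transl_index:
  assumes "discrete_set G" "cocompact G" "a \<in> transl" "b \<in> transl" "Im (a * cnj b) \<noteq> 0"
  obtains N :: nat where "N > 0" "\<And>l. l \<in> transl \<Longrightarrow> of_nat N * l \<in> int_span a b"
proof -
  have *: "\<exists>m\<in>int_span a b. l - m \<in> transl \<inter> cball 0 (norm a + norm b)" if "l \<in> transl" for l
  proof -
    define x y where "x = Im (l * cnj b) / Im (a * cnj b)" and "y = Im (a * cnj l) / Im (a * cnj b)"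
    have l: "l = of_real x * a + of_real y * b"
      using plane_coordinates[OF assms(5)] by (simp add: x_def y_def)
    define m where "m = of_int \<lfloor>x\<rfloor> * a + of_int \<lfloor>y\<rfloor> * b"
    have "l - m = of_real (frac x) * a + of_real (frac y) * b"
      by (simp add: l m_def frac_def algebra_simps)
    then have "norm (l - m) \<le> frac x * norm a + frac y * norm b"
      using norm_triangle_ineq[of "of_real (frac x) * a" "of_real (frac y) * b"]
      by (simp add: norm_mult)
    also have "\<dots> \<le> norm a + norm b"
      using frac_lt_1[of x] frac_lt_1[of y]
      by (intro add_mono mult_left_le_one_le) (auto intro: less_imp_le)
    finally have "norm (l - m) \<le> norm a + norm b" .
    moreover have m: "m \<in> int_span a b" unfolding m_def by (rule int_spanI) simp
    ultimately show ?thesis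
      using that int_span_subset_transl[OF assms(3,4)] transl_diff by auto
  qed
  show ?thesis
    by (rule multiple_in_subgroup[OF transl_finite[OF assms(1,2)] *])
       (use transl_int int_span_mult int_span_diff that in auto)
qed

text \<open>The argument for the plane lattice, repeated on the vertical line with the single
  generator \<open>c\<close>.\<close>

lemma centre_index:
  assumes "discrete_set G" "(0, c) \<in> nil_part" "c \<noteq> 0"
  obtains N :: nat where "N > 0" "\<And>t. (0, t) \<in> nil_part \<Longrightarrow> of_nat N * t \<in> int_multiples c"
proof -
  define Z where "Z = {t. (0, t) \<in> nil_part}"
  have *: "\<exists>m\<in>int_multiples c. t - m \<in> snd ` (nil_part \<inter> cball 0 \<bar>c\<bar>)" if "t \<in> Z" for t
  proof -
    define k where "k = \<lfloor>t / c\<rfloor>"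
    have "(0, t - k * c) \<in> nil_part"
      using nil_part_mult[OF _ nil_part_power[OF assms(2), of "- k"]] that by (fastforce simp: Z_def)
    moreover have "\<bar>t - k * c\<bar> \<le> \<bar>c\<bar>"
      unfolding k_def by (rule floor_remainder_le[OF assms(3)])
    then have "norm (0 :: complex, t - k * c) \<le> \<bar>c\<bar>"
      by (simp add: norm_Pair)
    ultimately show ?thesis by (force simp: int_multiples_def)
  qed
  have "finite (snd ` (nil_part \<inter> cball 0 \<bar>c\<bar>))" using nil_part_finite[OF assms(1)] by blast
  then obtain N :: nat where "N > 0" "\<And>t. t \<in> Z \<Longrightarrow> of_nat N * t \<in> int_multiples c"
  proof (rule multiple_in_subgroup[OF _ *])
    show "of_int j * h \<in> Z" if "h \<in> Z" for h j
      using nil_part_power[of 0 h j] that by (simp add: Z_def)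
  qed (use int_multiples_mult int_multiples_diff in auto)
  then show ?thesis by (intro that) (auto simp: Z_def)
qed

text \<open>Let \<open>l\<close> be a shortest nonzero translation. Then
  \<open>u * l + cnj u * l\<close> is \<open>2 * Re u\<close> times \<open>l\<close>, and
  subtracting an integer multiple of \<open>l\<close> leaves \<open>frac (2 * Re u)\<close> times
  \<open>l\<close>. This is a translation shorter than \<open>l\<close>, hence zero.\<close>

lemma crystallographic_restriction:
  assumes "discrete_set G" "cocompact G" "(x, t, u, False) \<in> G"
  shows "2 * Re u \<in> \<int>"
proof -
  obtain a b where ab: "a \<in> transl" "b \<in> transl" "Im (a * cnj b) \<noteq> 0" using transl_spans[OF assms(2)] by blast
  then have "a \<noteq> 0" by auto
  let ?S = "transl \<inter> cball 0 (norm a) - {0}"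
  have "finite ?S" "?S \<noteq> {}" using transl_finite[OF assms(1,2)] ab(1) \<open>a \<noteq> 0\<close> by auto
  then obtain l where l: "l \<in> ?S" "\<And>m. m \<in> ?S \<Longrightarrow> norm l \<le> norm m"
    using arg_min_if_finite(1)[of ?S norm] arg_min_least[of ?S _ norm] by blast
  have "u * l \<in> transl" "cnj u * l \<in> transl"
    using transl_rot[OF assms(3)] transl_rot[OF inverse[OF assms(3)]] l(1) by (auto simp: cj_def)
  then have "u * l + cnj u * l - of_int \<lfloor>2 * Re u\<rfloor> * l \<in> transl"
    using l(1) by (intro transl_diff transl_add transl_int) auto
  moreover have "u * l + cnj u * l - of_int \<lfloor>2 * Re u\<rfloor> * l = of_real (frac (2 * Re u)) * l"
    by (simp add: frac_def complex_eq_iff algebra_simps)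
  ultimately have transl: "of_real (frac (2 * Re u)) * l \<in> transl" by simp
  have "norm (of_real (frac (2 * Re u)) * l) < norm l"
    using l(1) frac_lt_1[of "2 * Re u"] by (simp add: norm_mult)
  with l transl have "of_real (frac (2 * Re u)) * l = 0" by force
  then show ?thesis using l(1) by (simp add: frac_eq_0_iff)
qed

section \<open>Bounded denominators for all coordinates\<close>

lemma rational_coordinates:
  fixes N N' :: nat
  assumes a: "(a, 0) \<in> nil_part" and b: "(b, 0) \<in> nil_part" and \<delta>: "Im (a * cnj b) \<noteq> 0"
    and N: "N > 0" "\<And>l. l \<in> transl \<Longrightarrow> of_nat N * l \<in> int_span a b"
    and N': "N' > 0" "\<And>t. (0, t) \<in> nil_part \<Longrightarrow> of_nat N' * t \<in> int_multiples (Im (a * cnj b))"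
    and torsion: "\<And>x t u. (x, t, u, False) \<in> G \<Longrightarrow> u ^ 12 = 1"
    and reflection: "\<And>x t u. (x, t, u, True) \<in> G \<Longrightarrow> \<exists>y v. (y, 0, v, True) \<in> G"
  obtains M :: nat where "M > 0" "\<And>x t u e. (x, t, u, e) \<in> G \<Longrightarrow> of_nat M * x \<in> int_span a b"
    "\<And>x t u e. (x, t, u, e) \<in> G \<Longrightarrow> of_nat M * t \<in> int_multiples (Im (a * cnj b))"
proof -
  define \<delta> where "\<delta> = Im (a * cnj b)"
  \<comment> \<open>\<open>N1\<close> clears the vertical coordinates of \<open>nil_part\<close>,
    \<open>N2\<close> the plane coordinates of all of \<open>G\<close>, and \<open>N3\<close> both
    kinds of coordinates of all of \<open>G\<close>.\<close>
  define N1 where "N1 = N * N'"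
  define N2 where "N2 = 4 * N1"
  define N3 where "N3 = 12 * N1 * N2 * N2"
  note \<delta>_nz = \<delta>[folded \<delta>_def]
  have nil_part: "of_nat N1 * s \<in> int_multiples \<delta>" if ls: "(l, s) \<in> nil_part" for l s
  proof -
    obtain m n where mn: "of_nat N * l = of_int m * a + of_int n * b"
      using N(2)[of l] ls unfolding transl_def int_span_def by blast
    \<comment> \<open>The product of the powers of the horizontal lifts lies over the same point as
      the \<open>N\<close>-th power of \<open>(l, s)\<close>, so their quotient is central.\<close>
    have "(of_nat N * l, 2 * m * n * \<delta>) \<in> nil_part"
      using nil_part_mult[OF nil_part_power[OF a, of m] nil_part_power[OF b, of n]]
      unfolding mn by (simp add: \<delta>_def algebra_simps)
    from nil_part_mult[OF nil_part_power[OF ls, of "int N"] nil_part_inv[OF this]]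
    have "(0, of_nat N * s - 2 * m * n * \<delta>) \<in> nil_part" by simp
    from N'(2)[OF this] have "of_nat N' * (of_nat N * s - 2 * m * n * \<delta>) \<in> int_multiples \<delta>"
      by (simp add: \<delta>_def)
    from int_multiples_add[OF this int_multiplesI[of _ "2 * N' * m * n"]]
    show ?thesis by (simp add: N1_def algebra_simps)
  qed
  \<comment> \<open>Some lift is conjugated by the element to a lift of \<open>l\<close>. Both
    vertical coordinates are controlled by \<open>N1\<close>, and they differ, up to sign, by four
    times the pairing.\<close>
  have pairing: "of_nat N2 * Im (x * cnj l) \<in> int_multiples \<delta>"
    if g: "(x, t, u, e) \<in> G" and l: "l \<in> transl" for x t u e l
  proof -
    have "cj e (cnj u * l) \<in> transl"
      using transl_rot[OF inverse[OF g] l] by (simp add: cj_def split: if_splits)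
    then obtain s where s: "(cj e (cnj u * l), s) \<in> nil_part" by (auto simp: transl_def)
    have "u * cj e (cj e (cnj u * l)) = l"
      using unit_mult_cnj[OF unit[OF g]] by (simp add: cj_def mult.assoc[symmetric])
    with nil_part_conj[OF g s] have "(l, sg e s + 4 * Im (x * cnj l)) \<in> nil_part" by simp
    from int_multiples_diff[OF nil_part[OF this] int_multiples_mult[OF nil_part[OF s], of "if e then -1 else 1"]]
    show ?thesis by (simp add: N2_def sg_def algebra_simps split: if_splits)
  qed
  have N2: "of_nat N2 * x \<in> int_span a b" if g: "(x, t, u, e) \<in> G" for x t u e
  proof -
    obtain k k' where k: "of_nat N2 * Im (x * cnj a) = of_int k * \<delta>" "of_nat N2 * Im (x * cnj b) = of_int k' * \<delta>"
      using pairing[OF g, of a] pairing[OF g, of b] a b unfolding transl_def int_multiples_def by blast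
    have "Im (a * cnj x) = - Im (x * cnj a)" by simp
    with k have "of_nat N2 * (Im (x * cnj b) / \<delta>) = of_int k'" "of_nat N2 * (Im (a * cnj x) / \<delta>) = of_int (- k)"
      using \<delta>_nz by (simp_all add: field_simps)
    then have "complex_of_real (of_nat N2 * (Im (x * cnj b) / \<delta>)) * a + complex_of_real (of_nat N2 * (Im (a * cnj x) / \<delta>)) * b
      \<in> int_span a b" by (intro int_spanI[of _ k' _ "- k"]) simp
    also have "complex_of_real (of_nat N2 * (Im (x * cnj b) / \<delta>)) * a + complex_of_real (of_nat N2 * (Im (a * cnj x) / \<delta>)) * b
      = of_nat N2 * (complex_of_real (Im (x * cnj b) / \<delta>) * a + complex_of_real (Im (a * cnj x) / \<delta>) * b)"
      by (simp only: of_real_mult of_real_of_nat_eq distrib_left mult.assoc)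
    also have "\<dots> = of_nat N2 * x" using plane_coordinates[OF \<delta>, of x] by (simp only: \<delta>_def)
    finally show ?thesis .
  qed
  \<comment> \<open>Both \<open>x\<close> and the plane component of the product are controlled by
    \<open>N2\<close>; the summand \<open>x\<close> in the second argument contributes nothing to
    the form.\<close>
  have cocycle: "of_nat (N2 * N2) * Im (x * cnj (u * cj e y)) \<in> int_multiples \<delta>"
    if "(x, t, u, e) \<in> G" "(y, s, v, f) \<in> G" for x t u e y s v f
  proof -
    have "Im ((of_nat N2 * x) * cnj (of_nat N2 * (x + u * cj e y))) \<in> int_multiples \<delta>"
      using Im_int_span[OF N2[OF that(1)] N2[OF mult[OF that]]] by (simp add: \<delta>_def int_multiples_def)
    also have "Im ((of_nat N2 * x) * cnj (of_nat N2 * (x + u * cj e y))) = of_nat (N2 * N2) * Im (x * cnj (x + u * cj e y))"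
      by (simp add: algebra_simps)
    also have "Im (x * cnj (x + u * cj e y)) = Im (x * cnj (u * cj e y))"
      by (simp add: algebra_simps)
    finally show ?thesis .
  qed
  \<comment> \<open>The \<open>n\<close>-th power has vertical coordinate \<open>n * t\<close> up to
    cocycle terms. For \<open>n = 12\<close> the rotation is trivial, so the bound for
    \<open>nil_part\<close> applies.\<close>
  have rot: "of_nat N3 * t \<in> int_multiples \<delta>" if g: "(x, t, u, False) \<in> G" for x t u
  proof -
    have "\<exists>y s. (y, s, u ^ n, False) \<in> G \<and> of_nat (N2 * N2) * (s - of_nat n * t) \<in> int_multiples \<delta>" for n :: nat
    proof (induction n)
      case 0
      then show ?case using one int_multiplesI[of 0 0] by (intro exI[of _ 0]) simp
    next
      case (Suc n)
      then obtain y s where y: "(y, s, u ^ n, False) \<in> G" "of_nat (N2 * N2) * (s - of_nat n * t) \<in> int_multiples \<delta>"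
        by blast
      let ?c = "Im (x * cnj (u * y))"
      have "(x + u * y, t + s + 2 * ?c, u ^ Suc n, False) \<in> G"
        using mult[OF g y(1)] by (simp add: cj_def sg_def)
      moreover have "of_nat (N2 * N2) * (s - of_nat n * t) + of_int 2 * (of_nat (N2 * N2) * ?c) \<in> int_multiples \<delta>"
        using int_multiples_add[OF y(2) int_multiples_mult[OF cocycle[OF g y(1)], of 2]] by (simp add: cj_def)
      then have "of_nat (N2 * N2) * (t + s + 2 * ?c - of_nat (Suc n) * t) \<in> int_multiples \<delta>"
        by (simp add: algebra_simps)
      ultimately show ?case by blast
    qed
    from this[of 12] obtain y s where
      y: "(y, s, 1, False) \<in> G" "of_nat (N2 * N2) * (s - 12 * t) \<in> int_multiples \<delta>"
      using torsion[OF g] by auto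
    have "of_int (int (N2 * N2)) * (of_nat N1 * s) - of_int (int N1) * (of_nat (N2 * N2) * (s - 12 * t)) \<in> int_multiples \<delta>"
      using y by (intro int_multiples_diff int_multiples_mult nil_part[of y]) (auto simp: nil_part_iff)
    then show ?thesis by (simp add: N3_def algebra_simps)
  qed
  have "of_nat N3 * t \<in> int_multiples \<delta>" if g: "(x, t, u, e) \<in> G" for x t u e
  proof (cases e)
    case False
    then show ?thesis using rot g by simp
  next
    case True
    \<comment> \<open>Multiplying by a reversing element with vertical coordinate 0 yields an
      orientation-preserving element whose vertical coordinate is \<open>t\<close> plus a cocycle
      term.\<close>
    then obtain y v where y: "(y, 0, v, True) \<in> G" using reflection[of x t u] g by auto
    let ?c = "Im (x * cnj (u * cj e y))"
    have "of_nat N3 * (t + 2 * ?c) - of_int (2 * 12 * int N1) * (of_nat (N2 * N2) * ?c) \<in> int_multiples \<delta>"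
      using mult[OF g y] True
      by (intro int_multiples_diff int_multiples_mult cocycle[OF g y] rot) (simp add: sg_def)
    then show ?thesis by (simp add: N3_def algebra_simps)
  qed
  moreover have "of_nat N3 * x \<in> int_span a b" if g: "(x, t, u, e) \<in> G" for x t u e
    using int_span_mult[OF N2[OF g], of "12 * N1 * N2"] by (simp add: N3_def mult_ac)
  moreover have "N3 > 0" using N(1) N'(1) by (simp add: N3_def N2_def N1_def)
  ultimately show ?thesis using that unfolding \<delta>_def by blast
qed

end

section \<open>From bounded denominators to an integral embedding\<close>

definition nil_embeds :: "nilisom set \<Rightarrow> complex set \<Rightarrow> bool" where
  "nil_embeds G R \<longleftrightarrow>
    (\<exists>\<phi>. \<phi> \<in> hom (NilIsom\<lparr>carrier := G\<rparr>) (NilIsom\<lparr>carrier := NilR R\<rparr>) \<and> inj_on \<phi> G)"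

definition plane_conj :: "(complex \<Rightarrow> complex) \<Rightarrow> complex \<Rightarrow> bool \<Rightarrow> complex \<Rightarrow> bool" where
  "plane_conj A u e u' \<longleftrightarrow> (\<forall>z. A (u * cj e z) = u' * cj e (A z))"

text \<open>As \<open>A\<close> multiplies the form by \<open>d\<close>, the map
  \<open>(x, t) \<mapsto> (A x, d * t)\<close> respects the Heisenberg product. The dilation with
  factors \<open>M\<close> and \<open>M ^ 2\<close> respects it too and makes the coordinates
  integral.\<close>

lemma (in nil_subgroup) nil_embeds_integral:
  fixes A :: "complex \<Rightarrow> complex" and M :: nat
  assumes M: "M > 0" "\<And>x t u e. (x, t, u, e) \<in> G \<Longrightarrow> of_nat M * x \<in> int_span a b"
    "\<And>x t u e. (x, t, u, e) \<in> G \<Longrightarrow> of_nat M * t \<in> int_multiples (Im (a * cnj b))"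
    and A: "\<And>x y. A (x + y) = A x + A y" "\<And>r x. A (of_real r * x) = of_real r * A x"
    and d: "d \<noteq> 0" "\<And>x y. Im (A x * cnj (A y)) = d * Im (x * cnj y)"
    and ab: "A a = 1" "A b = w"
    and R: "\<And>m n. of_int m + of_int n * w \<in> R"
    and conj: "\<And>x t u e. (x, t, u, e) \<in> G \<Longrightarrow> \<exists>u'\<in>R. norm u' = 1 \<and> plane_conj A u e u'"
  shows "nil_embeds G R"
proof -
  define \<phi> :: "nilisom \<Rightarrow> nilisom" where
    \<comment> \<open>The third entry is the \<open>u'\<close> of the intertwining relation,
      evaluated at \<open>a\<close> where \<open>A a = 1\<close>.\<close>
    "\<phi> g = (case g of (x, t, u, e) \<Rightarrow> (of_nat M * A x, of_nat M ^ 2 * d * t, A (u * cj e a), e))" for g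
  have \<phi>: "\<phi> (x, t, u, e) = (of_nat M * A x, of_nat M ^ 2 * d * t, A (u * cj e a), e)" for x t u e
    by (simp add: \<phi>_def)
  have U: "A (u * cj e a) \<in> R" "norm (A (u * cj e a)) = 1" "A (u * cj e z) = A (u * cj e a) * cj e (A z)"
    if g: "(x, t, u, e) \<in> G" for x t u e z
  proof -
    obtain u' where u': "u' \<in> R" "norm u' = 1" "\<And>z. A (u * cj e z) = u' * cj e (A z)"
      using conj[OF g] unfolding plane_conj_def by blast
    then have "A (u * cj e a) = u'" by (simp add: ab cj_def)
    with u' show "A (u * cj e a) \<in> R" "norm (A (u * cj e a)) = 1" "A (u * cj e z) = A (u * cj e a) * cj e (A z)"
      by auto
  qed
  have Aint: "A (of_int m * x) = of_int m * A x" for m x using A(2)[of "of_int m" x] by simp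
  have Anat: "A (of_nat m * x) = of_nat m * A x" for m x using A(2)[of "of_nat m" x] by simp
  \<comment> \<open>A nonzero multiple of a nondegenerate form is preserved, so \<open>A\<close> has
    trivial kernel.\<close>
  have A0: "x = 0" if "A x = 0" for x
  proof -
    have "d * Im (x * cnj 1) = 0" "d * Im (x * cnj \<i>) = 0"
      using d(2)[of x 1] d(2)[of x \<i>] that by simp_all
    with d(1) show "x = 0" by (simp add: complex_eq_iff)
  qed
  have Ainj: "x = y" if "A x = A y" for x y
    using A0[of "x + of_real (-1) * y"] that unfolding A by simp
  have a0: "a \<noteq> 0" using ab(1) A(2)[of 0 0] by auto
  have "\<phi> g \<in> NilR R" if "g \<in> G" for g
  proof -
    obtain x t u e where g: "g = (x, t, u, e)" by (cases g)
    with that have gG: "(x, t, u, e) \<in> G" by simp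
    obtain m n where "of_nat M * x = of_int m * a + of_int n * b"
      using M(2)[OF gG] by (auto simp: int_span_def)
    then have "A (of_nat M * x) = of_int m + of_int n * w" by (simp only: A Aint ab) simp
    then have 1: "of_nat M * A x \<in> R" using R Anat by simp
    obtain k where k: "of_nat M * t = of_int k * Im (a * cnj b)"
      using M(3)[OF gG] by (auto simp: int_multiples_def)
    \<comment> \<open>One factor \<open>M\<close> clears the denominator of \<open>t\<close>, and
      \<open>d\<close> turns the unit \<open>Im (a * cnj b)\<close> into
      \<open>- Im w\<close>.\<close>
    have "of_nat M ^ 2 * d * t = of_nat M * d * (of_nat M * t)" by (simp add: power2_eq_square)
    also have "\<dots> = of_nat M * of_int k * (d * Im (a * cnj b))" unfolding k by simp
    also have "d * Im (a * cnj b) = - Im w" using d(2)[of a b] by (simp add: ab)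
    finally have "of_nat M ^ 2 * d * t = Im (of_int 0 + of_int (- int M * k) * w)" by simp
    then have 2: "of_nat M ^ 2 * d * t \<in> Im ` R" using R by blast
    show ?thesis using 1 2 U(1,2)[OF gG] by (simp add: g \<phi> NilR_def)
  qed
  moreover have "\<phi> (nil_mult g h) = nil_mult (\<phi> g) (\<phi> h)" if "g \<in> G" "h \<in> G" for g h
  proof -
    obtain x t u e y s v f where g: "g = (x, t, u, e)" "h = (y, s, v, f)" by (cases g, cases h)
    with that have gG: "(x, t, u, e) \<in> G" "(y, s, v, f) \<in> G" by auto
    have 1: "of_nat M * A (x + u * cj e y) = of_nat M * A x + A (u * cj e a) * cj e (of_nat M * A y)"
      unfolding A(1) U(3)[OF gG(1), of y] by (simp add: cj_def distrib_left mult_ac)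
    have "A (u * cj e v * cj (e \<noteq> f) a) = A (u * cj e (v * cj f a))"
      by (rule arg_cong[of _ _ A]) (simp add: cj_def)
    then have 3: "A (u * cj e v * cj (e \<noteq> f) a) = A (u * cj e a) * cj e (A (v * cj f a))"
      by (simp only: U(3)[OF gG(1), of "v * cj f a"])
    have "of_nat M * A x * cnj (A (u * cj e a) * cj e (of_nat M * A y)) =
        of_nat M ^ 2 * (A x * cnj (A (u * cj e a) * cj e (A y)))"
      by (simp add: cj_def power2_eq_square)
    also have "\<dots> = of_real (of_nat M ^ 2) * (A x * cnj (A (u * cj e y)))"
      unfolding U(3)[OF gG(1), of y] by simp
    finally have "Im (of_nat M * A x * cnj (A (u * cj e a) * cj e (of_nat M * A y))) =
        of_nat M ^ 2 * Im (A x * cnj (A (u * cj e y)))"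
      by (simp only: Im_complex_of_real_mult)
    then have 2: "Im (of_nat M * A x * cnj (A (u * cj e a) * cj e (of_nat M * A y))) =
        of_nat M ^ 2 * d * Im (x * cnj (u * cj e y))"
      unfolding d(2) by simp
    show ?thesis unfolding g \<phi> nil_mult_eq 1 2 3
      by (simp add: sg_def algebra_simps)
  qed
  moreover have "inj_on \<phi> G"
  proof (rule inj_onI)
    fix g h assume gh: "\<phi> g = \<phi> h"
    obtain x t u e y s v f where g: "g = (x, t, u, e)" "h = (y, s, v, f)" by (cases g, cases h)
    have "cj e a \<noteq> 0" using a0 by (simp add: cj_def)
    with gh show "g = h" using M(1) d(1) Ainj[of x y] Ainj[of "u * cj e a" "v * cj f a"] by (auto simp: g \<phi>)
  qed
  ultimately show ?thesis unfolding nil_embeds_def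
    by (intro exI[of _ \<phi>]) (auto simp: hom_def NilIsom_def)
qed

section \<open>Conjugation by Heisenberg elements\<close>

definition nil_conj :: "complex \<Rightarrow> real \<Rightarrow> nilisom \<Rightarrow> nilisom" where
  "nil_conj \<eta> s g = nil_mult (nil_mult (\<eta>, s, 1, False) g) (nil_inv (\<eta>, s, 1, False))"

lemma nil_conj_eq:
  "nil_conj \<eta> s (x, t, u, e) =
    (\<eta> + x - u * cj e \<eta>,
     s + t + 2 * Im (\<eta> * cnj x) - sg e s - 2 * Im ((\<eta> + x) * cnj (u * cj e \<eta>)), u, e)"
  by (cases e) (simp_all add: nil_conj_def nil_inv_eq nil_mult_eq cj_def sg_def)

lemma inj_nil_conj: "inj (nil_conj \<eta> s)"
proof (rule injI)
  fix g h assume gh: "nil_conj \<eta> s g = nil_conj \<eta> s h"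
  obtain x t u e y r v f where "g = (x, t, u, e)" "h = (y, r, v, f)" by (cases g, cases h)
  with gh show "g = h" by (auto simp: nil_conj_eq)
qed

lemma group_hom_nil_conj: "group_hom NilIsom NilIsom (nil_conj \<eta> s)"
proof -
  interpret group NilIsom by (rule group_NilIsom)
  define h where "h = (\<eta>, s, 1 :: complex, False)"
  have h: "h \<in> carrier NilIsom" by (simp add: h_def NilIsom_def)
  have eq: "nil_conj \<eta> s g = h \<otimes>\<^bsub>NilIsom\<^esub> g \<otimes>\<^bsub>NilIsom\<^esub> inv\<^bsub>NilIsom\<^esub> h" for g
    using inv_NilIsom[OF h] by (simp add: nil_conj_def h_def NilIsom_def)
  have "inv\<^bsub>NilIsom\<^esub> h \<otimes>\<^bsub>NilIsom\<^esub> (h \<otimes>\<^bsub>NilIsom\<^esub> z) = z" if "z \<in> carrier NilIsom" for z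
    using h that by (simp add: m_assoc[symmetric])
  then have "nil_conj \<eta> s \<in> hom NilIsom NilIsom"
    using h by (auto simp: hom_def eq m_assoc)
  then show ?thesis by (simp add: group_hom_def group_hom_axioms_def group_NilIsom)
qed

lemma (in nil_subgroup) nil_embeds_nil_conj:
  assumes "nil_embeds (nil_conj \<eta> s ` G) R"
  shows "nil_embeds G R"
proof -
  obtain \<phi> where \<phi>: "\<phi> \<in> hom (NilIsom\<lparr>carrier := nil_conj \<eta> s ` G\<rparr>) (NilIsom\<lparr>carrier := NilR R\<rparr>)"
    "inj_on \<phi> (nil_conj \<eta> s ` G)"
    using assms unfolding nil_embeds_def by blast
  have "nil_conj \<eta> s \<in> hom (NilIsom\<lparr>carrier := G\<rparr>) (NilIsom\<lparr>carrier := nil_conj \<eta> s ` G\<rparr>)"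
    using group_hom.homh[OF group_hom_nil_conj[of \<eta> s]] subgroup.subset[OF subgroup]
    by (auto simp: hom_def)
  from hom_compose[OF this \<phi>(1)] show ?thesis
    unfolding nil_embeds_def using comp_inj_on[OF inj_on_subset[OF inj_nil_conj] \<phi>(2)] by blast
qed

section \<open>Rotations with integral trace\<close>

lemma unit_quadratic:
  assumes "norm u = 1" "2 * Re u = of_int k"
  shows "u * u = of_int k * u - 1"
proof -
  have "u + cnj u = of_int k" using assms(2) by (simp add: complex_eq_iff)
  then have "of_int k * u = u * u + cnj u * u" by (metis distrib_right)
  then show ?thesis using unit_mult_cnj(2)[OF assms(1)] by simp
qed

lemma unit_trace_cases:
  assumes "norm u = 1" "2 * Re u = of_int k"
  obtains "u = 1" | "u = - 1" | "k = 0" | "k = 1" | "k = - 1"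
proof -
  have sq: "Re u ^ 2 + Im u ^ 2 = 1" using assms(1) cmod_power2[of u] by simp
  have "\<bar>Re u\<bar> \<le> 1" using abs_Re_le_cmod[of u] assms(1) by simp
  then have "real_of_int k \<le> real_of_int 2" "real_of_int (-2) \<le> real_of_int k"
    using assms(2) by simp_all
  then have "k \<in> {-2..2}" unfolding of_int_le_iff by simp
  then consider "k = -2" | "k = -1" | "k = 0" | "k = 1" | "k = 2" by fastforce
  then show ?thesis
  proof cases
    case 1
    then have "Re u = - 1" using assms(2) by simp
    then have "u = - 1" using sq by (simp add: complex_eq_iff)
    then show ?thesis by (rule that)
  next
    case 5
    then have "Re u = 1" using assms(2) by simp
    then have "u = 1" using sq by (simp add: complex_eq_iff)
    then show ?thesis by (rule that)
  qed (use that in auto)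
qed

text \<open>Apart from the units 1 and -1, trace 0 gives \<open>u ^ 2 = - 1\<close>, trace 1 gives
  \<open>u ^ 3 = - 1\<close> and trace -1 gives \<open>u ^ 3 = 1\<close>; 12 is a common
  exponent.\<close>

lemma unit_power_12:
  assumes "norm u = 1" "2 * Re u \<in> \<int>"
  shows "u ^ 12 = 1"
proof -
  obtain k where k: "2 * Re u = of_int k" using assms(2) by (elim Ints_cases)
  note q = unit_quadratic[OF assms(1) k]
  have pow: "u ^ 12 = (u * u) ^ 6" "u ^ 12 = (u * u * u) ^ 4"
    by (simp_all add: power_mult_distrib flip: power_add)
  show ?thesis using unit_trace_cases[OF assms(1) k]
  proof cases
    case 3
    then show ?thesis using q unfolding pow(1) by simp
  next
    case 4
    then have uu: "u * u = u - 1" using q by simp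
    have "u * u * u = u * u - u" by (simp only: uu left_diff_distrib) simp
    then have "u * u * u = - 1" by (simp add: uu)
    then show ?thesis unfolding pow(2) by simp
  next
    case 5
    then have uu: "u * u = - u - 1" using q by simp
    have "u * u * u = - (u * u) - u" by (simp only: uu left_diff_distrib) (simp add: uu)
    then have "u * u * u = 1" by (simp add: uu)
    then show ?thesis unfolding pow(2) by simp
  qed simp_all
qed

text \<open>Conjugating by \<open>(\<eta>, s)\<close> makes the lifts of \<open>a\<close>,
  \<open>b\<close> and one reversing element horizontal without changing point parts, so the
  denominators are bounded in the conjugate. The embedding of the conjugate is then pulled
  back.\<close>

lemma (in nil_subgroup) nil_embeds_basis:
  fixes A :: "complex \<Rightarrow> complex"
  assumes G: "discrete_set G" "cocompact G"
    and ab: "a \<in> transl" "b \<in> transl" "Im (a * cnj b) \<noteq> 0"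
    and A: "\<And>x y. A (x + y) = A x + A y" "\<And>r x. A (of_real r * x) = of_real r * A x"
    and d: "d \<noteq> 0" "\<And>x y. Im (A x * cnj (A y)) = d * Im (x * cnj y)"
    and Aab: "A a = 1" "A b = w"
    and R: "\<And>m n. of_int m + of_int n * w \<in> R"
    and conj: "\<And>x t u e. (x, t, u, e) \<in> G \<Longrightarrow> \<exists>u'\<in>R. norm u' = 1 \<and> plane_conj A u e u'"
  shows "nil_embeds G R"
proof -
  define \<delta> where "\<delta> = Im (a * cnj b)"
  obtain ta tb where t: "(a, ta) \<in> nil_part" "(b, tb) \<in> nil_part" using ab by (auto simp: transl_def)
  \<comment> \<open>Conjugation adds \<open>4 * Im (\<eta> * cnj l)\<close> to the vertical
    coordinate over \<open>l\<close>; these coefficients cancel \<open>ta\<close> and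
    \<open>tb\<close>.\<close>
  define p q where "p = - tb / (4 * \<delta>)" and "q = ta / (4 * \<delta>)"
  define \<eta> where "\<eta> = of_real p * a + of_real q * b"
  have "Im (\<eta> * cnj a) = q * Im (b * cnj a)" "Im (\<eta> * cnj b) = p * Im (a * cnj b)"
    unfolding \<eta>_def by (simp_all add: algebra_simps)
  moreover have "Im (b * cnj a) = - \<delta>" by (simp add: \<delta>_def)
  ultimately have \<eta>: "4 * Im (\<eta> * cnj a) = - ta" "4 * Im (\<eta> * cnj b) = - tb"
    using ab(3) by (simp_all only: p_def q_def flip: \<delta>_def) simp_all
  obtain s where s: "\<And>x t u. (x, t, u, True) \<in> G \<Longrightarrow> \<exists>y v. (y, 0, v, True) \<in> nil_conj \<eta> s ` G"
  proof (cases "\<exists>x t u. (x, t, u, True) \<in> G")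
    case True
    then obtain x t u where g: "(x, t, u, True) \<in> G" by blast
    \<comment> \<open>A reversing element changes the sign of \<open>s\<close>, so \<open>s\<close>
      enters its conjugate twice; hence the division by 2. On translations \<open>s\<close> has no
      effect.\<close>
    define s where "s = - (t + 2 * Im (\<eta> * cnj x) - 2 * Im ((\<eta> + x) * cnj (u * cnj \<eta>))) / 2"
    have "nil_conj \<eta> s (x, t, u, True) = (\<eta> + x - u * cnj \<eta>, 0, u, True)"
      unfolding nil_conj_eq cj_def sg_def s_def by simp
    then have "(\<eta> + x - u * cnj \<eta>, 0, u, True) \<in> nil_conj \<eta> s ` G" using g by (metis imageI)
    then show ?thesis using that by blast
  qed (use that in blast)
  let ?H = "nil_conj \<eta> s ` G"
  interpret H: nil_subgroup ?H
    by (rule nil_subgroup.intro, rule group_hom.subgroup_img_is_subgroup[OF group_hom_nil_conj subgroup])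
  have H: "\<exists>x t. (x, t, u, e) \<in> G" if "(y, r, u, e) \<in> ?H" for y r u e
    using that by (force simp: nil_conj_eq)
  have tr: "nil_conj \<eta> s (l, r, 1, False) = (l, r + 4 * Im (\<eta> * cnj l), 1, False)" for l r
    by (simp add: nil_conj_eq cj_def sg_def algebra_simps)
  have H_nil_part: "(l, r) \<in> H.nil_part \<longleftrightarrow> (l, r - 4 * Im (\<eta> * cnj l)) \<in> nil_part" for l r
  proof
    assume "(l, r) \<in> H.nil_part"
    then obtain g where g: "g \<in> G" "nil_conj \<eta> s g = (l, r, 1, False)" by (auto simp: H.nil_part_iff)
    then have "g = (l, r - 4 * Im (\<eta> * cnj l), 1, False)"
      using tr[of l "r - 4 * Im (\<eta> * cnj l)"] injD[OF inj_nil_conj, of \<eta> s g] by simp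
    with g(1) show "(l, r - 4 * Im (\<eta> * cnj l)) \<in> nil_part" by (simp add: nil_part_iff)
  next
    assume "(l, r - 4 * Im (\<eta> * cnj l)) \<in> nil_part"
    from imageI[OF this[unfolded nil_part_iff], of "nil_conj \<eta> s"]
    show "(l, r) \<in> H.nil_part" unfolding tr H.nil_part_iff by simp
  qed
  then have H_transl: "H.transl \<subseteq> transl" by (auto simp: H.transl_def transl_def)
  obtain N :: nat where N: "N > 0" "\<And>l. l \<in> transl \<Longrightarrow> of_nat N * l \<in> int_span a b"
    using transl_index[OF G ab] by blast
  have "(0, 4 * \<delta>) \<in> nil_part" "4 * \<delta> \<noteq> 0" using nil_part_commutator[OF t] ab(3) by (simp_all add: \<delta>_def)
  then obtain N' :: nat where N': "N' > 0" "\<And>t. (0, t) \<in> nil_part \<Longrightarrow> of_nat N' * t \<in> int_multiples (4 * \<delta>)"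
    using centre_index[OF G(1)] by blast
  have "int_multiples (4 * \<delta>) \<subseteq> int_multiples \<delta>"
  proof
    fix r assume "r \<in> int_multiples (4 * \<delta>)"
    then obtain k where "r = of_int k * (4 * \<delta>)" by (auto simp: int_multiples_def)
    then show "r \<in> int_multiples \<delta>" by (intro int_multiplesI[of _ "4 * k"]) simp
  qed
  then have N'\<delta>: "of_nat N' * t \<in> int_multiples \<delta>" if "(0, t) \<in> H.nil_part" for t
    using N'(2)[of t] that H_nil_part[of 0 t] by auto
  obtain M :: nat where M: "M > 0" "\<And>x t u e. (x, t, u, e) \<in> ?H \<Longrightarrow> of_nat M * x \<in> int_span a b"
    "\<And>x t u e. (x, t, u, e) \<in> ?H \<Longrightarrow> of_nat M * t \<in> int_multiples (Im (a * cnj b))"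
  proof (rule H.rational_coordinates[of a b N N'])
    show "(a, 0) \<in> H.nil_part" "(b, 0) \<in> H.nil_part" using t by (simp_all only: H_nil_part \<eta>) simp_all
    show "u ^ 12 = 1" if "(x, t, u, False) \<in> ?H" for x t u
      using H[OF that] crystallographic_restriction[OF G] unit unit_power_12 by blast
    show "\<exists>y v. (y, 0, v, True) \<in> ?H" if "(x, t, u, True) \<in> ?H" for x t u
      using H[OF that] s by blast
  qed (use ab N N' N'\<delta> H_transl in \<open>auto simp: \<delta>_def\<close>)
  have "nil_embeds ?H R"
    by (rule H.nil_embeds_integral[OF M A d Aab R]) (use H conj in blast)+
  then show ?thesis by (rule nil_embeds_nil_conj)
qed

section \<open>Integers of the two quadratic fields\<close>

lemma algebraic_int_quadratic:
  fixes x :: complex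
  assumes "x * x = of_int p * x + of_int q"
  shows "algebraic_int x"
proof (rule algebraic_int.intros)
  show "lead_coeff [:- of_int q, - of_int p, 1 :: complex:] = 1" by simp
  show "\<forall>i. coeff [:- of_int q, - of_int p, 1 :: complex:] i \<in> \<int>"
    by (auto simp: coeff_pCons split: nat.splits)
  show "poly [:- of_int q, - of_int p, 1:] x = 0"
    using assms by (simp add: algebra_simps)
qed

text \<open>A common form of both fields, so that \<open>\<i>\<close> and \<open>zeta3\<close> can
  be treated together.\<close>

definition quad_field :: "complex \<Rightarrow> complex set" where
  "quad_field w = {of_rat a + of_rat b * w | a b. True}"

lemma quad_fieldI: "z = of_rat p + of_rat q * w \<Longrightarrow> z \<in> quad_field w"
  by (auto simp: quad_field_def)

text \<open>The element has trace \<open>2 * m + n * k\<close> and norm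
  \<open>m * m + m * n * k + n * n\<close>, which gives its monic quadratic equation.\<close>

lemma ring_of_integers_quad_field:
  assumes "w * w = of_int k * w - 1"
  shows "of_int m + of_int n * w \<in> ring_of_integers (quad_field w)"
proof -
  have "of_int m + of_int n * w \<in> quad_field w"
    by (rule quad_fieldI[of _ "of_int m" "of_int n"]) simp
  moreover have "(of_int m + of_int n * w) * (of_int m + of_int n * w)
      = of_int (2 * m + n * k) * (of_int m + of_int n * w) + of_int (- m * m - m * n * k - n * n)"
  proof -
    have "(of_int m + of_int n * w) * (of_int m + of_int n * w)
        = of_int (m * m) + of_int (2 * m * n) * w + of_int (n * n) * (w * w)"
      by (simp add: algebra_simps)
    then show ?thesis unfolding assms by (simp add: algebra_simps)
  qed
  then have "algebraic_int (of_int m + of_int n * w)" by (rule algebraic_int_quadratic)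
  ultimately show ?thesis by (simp add: ring_of_integers_def)
qed

lemma zeta3_quadratic: "zeta3 * zeta3 = of_int (- 1) * zeta3 - 1"
  by (simp add: zeta3_def complex_eq_iff)

text \<open>The trace leaves only primitive roots of unity of order 3, 4 and 6. The integer form of
  the relation makes the translation lattice stable under \<open>w\<close>.\<close>

lemma nontrivial_rotation_generates:
  assumes "norm u = 1" "2 * Re u \<in> \<int>" "u \<noteq> 1" "u \<noteq> - 1"
  obtains w m n where "w \<in> {\<i>, zeta3}" "w = of_int m + of_int n * u"
proof -
  obtain k where k: "2 * Re u = of_int k" using assms(2) by (elim Ints_cases)
  have sq: "Re u ^ 2 + Im u ^ 2 = 1" using assms(1) cmod_power2[of u] by simp
  have s3: "Im u = sqrt 3 / 2 \<or> Im u = - (sqrt 3 / 2)" if "(Re u) ^ 2 = 1 / 4"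
  proof -
    have "Im u ^ 2 = (sqrt 3 / 2) ^ 2" using sq that by (simp add: power_divide)
    then show ?thesis by (simp add: power2_eq_iff)
  qed
  show ?thesis using unit_trace_cases[OF assms(1) k]
  proof cases
    case 3
    then have "Re u = 0" using k by simp
    with sq have "Im u = 1 \<or> Im u = - 1" by (simp add: power2_eq_1_iff)
    then show ?thesis
      using \<open>Re u = 0\<close> that[of \<i> 0 1] that[of \<i> 0 "-1"] by (auto simp: complex_eq_iff)
  next
    case 4
    then have r: "Re u = 1 / 2" using k by simp
    with s3 have "Im u = sqrt 3 / 2 \<or> Im u = - (sqrt 3 / 2)" by (simp add: power_divide)
    then show ?thesis
      using r that[of zeta3 "-1" 1] that[of zeta3 0 "-1"] by (auto simp: complex_eq_iff zeta3_def)
  next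
    case 5
    then have r: "Re u = - 1 / 2" using k by simp
    with s3 have "Im u = sqrt 3 / 2 \<or> Im u = - (sqrt 3 / 2)" by (simp add: power_divide)
    then show ?thesis
      using r that[of zeta3 0 1] that[of zeta3 "-1" "-1"] by (auto simp: complex_eq_iff zeta3_def)
  qed (use assms in auto)
qed

section \<open>Lattice bases adapted to the point group\<close>

text \<open>If the reflection \<open>z \<mapsto> v * cnj z\<close> negated both vectors, then
  \<open>a * cnj b\<close> would equal its own conjugate and be real.\<close>

lemma axis_vector:
  assumes "norm v = 1" "Im (a * cnj b) \<noteq> 0"
  obtains l where "l = a \<or> l = b" "l + v * cnj l \<noteq> 0"
proof -
  have False if "a + v * cnj a = 0" "b + v * cnj b = 0"
  proof -
    have "a = - (v * cnj a)" "b = - (v * cnj b)" using that by (simp_all add: eq_neg_iff_add_eq_0)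
    then have "a * cnj b = (v * cnj v) * (cnj a * b)"
      by (metis (no_types, lifting) complex_cnj_cnj complex_cnj_minus complex_cnj_mult minus_mult_minus mult.assoc mult.left_commute)
    then have "a * cnj b = cnj (a * cnj b)" by (simp add: unit_mult_cnj(1)[OF assms(1)])
    then have "Im (a * cnj b) = - Im (a * cnj b)" by (metis cnj.simps(2))
    with assms(2) show False by linarith
  qed
  then show ?thesis using that by blast
qed

context nil_subgroup
begin

text \<open>Adding to \<open>l\<close> its reflected image times \<open>\<sigma>\<close> gives an
  eigenvector for \<open>\<sigma>\<close>; by \<open>axis_vector\<close>, some lattice vector makes
  it nonzero.\<close>

lemma axis_element:
  assumes "cocompact G" "(x, t, v, True) \<in> G" "\<sigma> = 1 \<or> \<sigma> = - 1"
  obtains a where "a \<in> transl" "a \<noteq> 0" "v * cnj a = of_int \<sigma> * a"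
proof -
  have v: "norm v = 1" "v * (cnj v * z) = z" for z
    using unit[OF assms(2)] unit_mult_cnj(1)[of v] by (simp_all add: mult.assoc[symmetric])
  obtain a0 b0 where ab: "a0 \<in> transl" "b0 \<in> transl" "Im (a0 * cnj b0) \<noteq> 0" using transl_spans[OF assms(1)] by blast
  have "norm (of_int \<sigma> * v) = 1" using v(1) assms(3) by (auto simp: norm_mult)
  from axis_vector[OF this ab(3)] obtain l where l: "l \<in> transl" "l + of_int \<sigma> * v * cnj l \<noteq> 0"
    using ab by blast
  have "l + of_int \<sigma> * (v * cj True l) \<in> transl"
    by (intro transl_add transl_int transl_rot[OF assms(2)] l)
  then show ?thesis
    using l(2) assms(3) v(2)
    by (intro that[of "l + of_int \<sigma> * v * cnj l"]) (auto simp: cj_def algebra_simps)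
qed

text \<open>Division by a lattice vector \<open>a\<close> sends the basis \<open>a\<close>,
  \<open>w * a\<close> to \<open>1\<close>, \<open>w\<close>. With \<open>a\<close> on the axis of
  one reflection, every reversing element acts on \<open>a\<close> as some rotation of
  \<open>G\<close> does, so reflections and rotations alike become units of the ring.\<close>

lemma nil_embeds_rotation:
  assumes G: "discrete_set G" "cocompact G"
    and w: "w * w = of_int k * w - 1" "Im w \<noteq> 0" "\<And>l. l \<in> transl \<Longrightarrow> w * l \<in> transl"
  shows "nil_embeds G (ring_of_integers (quad_field w))"
proof -
  let ?R = "ring_of_integers (quad_field w)"
  have "\<exists>a\<in>transl. a \<noteq> 0 \<and> (\<forall>x t v. (x, t, v, True) \<in> G \<longrightarrow>
      (\<exists>y s r. (y, s, r, False) \<in> G \<and> v * cnj a = r * a))"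
  proof (cases "\<exists>x t v. (x, t, v, True) \<in> G")
    case True
    then obtain x1 t1 v1 where g: "(x1, t1, v1, True) \<in> G" by blast
    obtain a where a: "a \<in> transl" "a \<noteq> 0" "v1 * cnj a = a" using axis_element[OF G(2) g, of 1] by auto
    have "\<exists>y s r. (y, s, r, False) \<in> G \<and> v * cnj a = r * a" if h: "(x, t, v, True) \<in> G" for x t v
    proof -
      have "v * cnj a = v * (cnj v1 * v1) * cnj a" by (simp add: unit_mult_cnj(2)[OF unit[OF g]])
      also have "\<dots> = v * cnj v1 * (v1 * cnj a)" by (simp only: mult.assoc)
      finally have "v * cnj a = v * cnj v1 * a" by (simp only: a(3))
      moreover have "\<exists>y s. (y, s, v * cnj v1, False) \<in> G"
        using mult[OF h g] by (simp only: cj_def if_True simp_thms) blast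
      ultimately show ?thesis by blast
    qed
    with a show ?thesis by blast
  next
    case False
    obtain a b where "a \<in> transl" "b \<in> transl" "Im (a * cnj b) \<noteq> 0" using transl_spans[OF G(2)] by blast
    then show ?thesis using False by (intro bexI[of _ a]) auto
  qed
  then obtain a where a: "a \<in> transl" "a \<noteq> 0" and
    refl: "\<And>x t v. (x, t, v, True) \<in> G \<Longrightarrow> \<exists>y s r. (y, s, r, False) \<in> G \<and> v * cnj a = r * a"
    by blast
  have wa: "w * a \<in> transl" using w(3) a(1) .
  have "a * cnj (w * a) = of_real (norm a ^ 2) * cnj w"
    using complex_norm_square[of a] by (simp add: mult_ac)
  then have \<delta>: "Im (a * cnj (w * a)) \<noteq> 0" using a(2) w(2) by (simp only: Im_complex_of_real_mult) simp
  obtain N :: nat where N: "N > 0" "\<And>l. l \<in> transl \<Longrightarrow> of_nat N * l \<in> int_span a (w * a)"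
    using transl_index[OF G a(1) wa \<delta>] by blast
  \<comment> \<open>Finite index of the span puts \<open>r\<close> only into the field; integrality
    comes from its integral trace and unit norm.\<close>
  have rot: "r \<in> ?R" if g: "(x, t, r, False) \<in> G" for x t r
  proof -
    obtain m n where "of_nat N * (r * a) = of_int m * a + of_int n * (w * a)"
      using N(2)[OF transl_rot[OF g a(1)]] by (auto simp: cj_def int_span_def)
    then have "(of_nat N * r) * a = (of_int m + of_int n * w) * a" by (simp add: algebra_simps)
    then have "of_nat N * r = of_int m + of_int n * w" using a(2) by simp
    then have "r = of_rat (of_int m / of_nat N) + of_rat (of_int n / of_nat N) * w"
      using N(1) by (simp add: of_rat_divide field_simps)
    then have "r \<in> quad_field w" by (rule quad_fieldI)
    moreover obtain j where "2 * Re r = of_int j"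
      using crystallographic_restriction[OF G g] by (elim Ints_cases)
    then have "algebraic_int r"
      using unit_quadratic[OF unit[OF g]] algebraic_int_quadratic[of r j "-1"] by simp
    ultimately show ?thesis by (simp add: ring_of_integers_def)
  qed
  show ?thesis
  proof (rule nil_embeds_basis[OF G a(1) wa \<delta>, of "\<lambda>z. z / a" "1 / norm a ^ 2" w])
    show "Im (x / a * cnj (y / a)) = 1 / norm a ^ 2 * Im (x * cnj y)" for x y
    proof -
      have "x / a * cnj (y / a) = of_real (1 / norm a ^ 2) * (x * cnj y)"
        using a(2) complex_norm_square[of a] by simp
      then show ?thesis by (simp only: Im_complex_of_real_mult)
    qed
    show "\<exists>u'\<in>?R. norm u' = 1 \<and> plane_conj (\<lambda>z. z / a) u e u'" if g: "(x, t, u, e) \<in> G" for x t u e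
    proof (rule bexI[of _ "u * cj e a / a"], intro conjI)
      show "norm (u * cj e a / a) = 1" using unit[OF g] a(2) by (simp add: norm_mult norm_divide)
      show "plane_conj (\<lambda>z. z / a) u e (u * cj e a / a)"
        using a(2) by (simp add: plane_conj_def cj_def)
      show "u * cj e a / a \<in> ?R"
      proof (cases e)
        case True
        then have "(x, t, u, True) \<in> G" using g by simp
        from refl[OF this] obtain y s r where "(y, s, r, False) \<in> G" "u * cnj a = r * a" by blast
        then show ?thesis using True rot a(2) by (simp add: cj_def)
      qed (use rot g a(2) in \<open>simp add: cj_def\<close>)
    qed
  qed (use a(2) ring_of_integers_quad_field[OF w(1)] in \<open>auto simp: add_divide_distrib\<close>)
qed

text \<open>The only rotations are 1 and -1, which commute with every linear map, so
  \<open>A\<close> need not be conformal. It suffices that \<open>a\<close> and \<open>b\<close> are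
  eigenvectors of the reflections with opposite signs: sending them to \<open>1\<close> and
  \<open>\<i>\<close> turns each reflection into complex conjugation up to sign.\<close>

lemma nil_embeds_no_rotation:
  assumes G: "discrete_set G" "cocompact G"
    and rot: "\<And>x t u. (x, t, u, False) \<in> G \<Longrightarrow> u = 1 \<or> u = - 1"
  shows "nil_embeds G (ring_of_integers (quad_field \<i>))"
proof -
  let ?R = "ring_of_integers (quad_field \<i>)"
  have R: "of_int m + of_int n * \<i> \<in> ?R" for m n
    by (rule ring_of_integers_quad_field[of _ 0]) simp
  have "\<exists>a\<in>transl. \<exists>b\<in>transl. Im (a * cnj b) \<noteq> 0 \<and> (\<forall>x t v. (x, t, v, True) \<in> G \<longrightarrow>
      (\<exists>\<sigma>. (\<sigma> = 1 \<or> \<sigma> = - 1) \<and> v * cnj a = \<sigma> * a \<and> v * cnj b = - \<sigma> * b))"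
  proof (cases "\<exists>x t v. (x, t, v, True) \<in> G")
    case True
    then obtain x1 t1 v1 where g: "(x1, t1, v1, True) \<in> G" by blast
    obtain a where a: "a \<in> transl" "a \<noteq> 0" "v1 * cnj a = a" using axis_element[OF G(2) g, of 1] by auto
    obtain b where b: "b \<in> transl" "b \<noteq> 0" "v1 * cnj b = - b" using axis_element[OF G(2) g, of "-1"] by auto
    \<comment> \<open>The two eigenvectors of the reflection are perpendicular, hence
      independent.\<close>
    have "a * cnj b = (v1 * cnj a) * cnj b" by (simp only: a(3))
    also have "\<dots> = (v1 * cnj b) * cnj a" by (simp only: mult_ac)
    also have "\<dots> = - (b * cnj a)" by (simp only: b(3) mult_minus_left)
    finally have "Re (a * cnj b) = - Re (b * cnj a)" by (simp only: uminus_complex.simps)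
    then have "Re (a * cnj b) = 0" by (simp add: mult.commute)
    moreover have "a * cnj b \<noteq> 0" using a b by simp
    ultimately have "Im (a * cnj b) \<noteq> 0" using complex_eqI[of "a * cnj b" 0] by auto
    moreover have "\<exists>\<sigma>. (\<sigma> = 1 \<or> \<sigma> = - 1) \<and> v * cnj a = \<sigma> * a \<and> v * cnj b = - \<sigma> * b"
      if h: "(x, t, v, True) \<in> G" for x t v
    proof -
      define \<sigma> where "\<sigma> = v * cnj v1"
      have "\<sigma> = 1 \<or> \<sigma> = - 1" using rot mult[OF h g] by (auto simp: cj_def \<sigma>_def)
      moreover have "v = \<sigma> * v1"
        using unit_mult_cnj(2)[OF unit[OF g]] by (simp add: \<sigma>_def mult.assoc)
      ultimately show ?thesis using a(3) b(3) by (intro exI[of _ \<sigma>]) (simp add: mult.assoc)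
    qed
    ultimately show ?thesis using a(1) b(1) by blast
  next
    case False
    then show ?thesis using transl_spans[OF G(2)] by metis
  qed
  then obtain a b where ab: "a \<in> transl" "b \<in> transl" "Im (a * cnj b) \<noteq> 0"
    and refl: "\<And>x t v. (x, t, v, True) \<in> G \<Longrightarrow>
      \<exists>\<sigma>. (\<sigma> = 1 \<or> \<sigma> = - 1) \<and> v * cnj a = \<sigma> * a \<and> v * cnj b = - \<sigma> * b"
    by blast
  define \<delta> where "\<delta> = Im (a * cnj b)"
  have \<delta>: "\<delta> \<noteq> 0" using ab(3) by (simp add: \<delta>_def)
  \<comment> \<open>The coordinates with respect to \<open>a\<close>, \<open>b\<close>, given by
    Cramer's rule.\<close>
  define A where "A z = Complex (Im (z * cnj b) / \<delta>) (Im (a * cnj z) / \<delta>)" for z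
  have Aadd: "A (x + y) = A x + A y" for x y
    by (simp add: A_def complex_eq_iff add_divide_distrib diff_divide_distrib algebra_simps)
  have Areal: "A (of_real r * x) = of_real r * A x" for r x
    by (simp add: A_def complex_eq_iff diff_divide_distrib algebra_simps)
  have Aneg: "A (- x) = - A x" for x using Areal[of "-1" x] by simp
  show ?thesis
  proof (rule nil_embeds_basis[OF G ab Aadd Areal, of "- 1 / \<delta>" \<i>])
    show "A a = 1" "A b = \<i>"
      using \<delta> by (simp_all add: A_def complex_eq_iff) (simp_all add: \<delta>_def algebra_simps)
    show "Im (A x * cnj (A y)) = - 1 / \<delta> * Im (x * cnj y)" for x y
    proof -
      have Im_Complex: "Im (Complex p q * cnj (Complex p' q')) = q * p' - p * q'" for p q p' q'
        by simp
      have "Im (A x * cnj (A y)) =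
          (Im (a * cnj x) * Im (y * cnj b) - Im (x * cnj b) * Im (a * cnj y)) / (\<delta> * \<delta>)"
        unfolding A_def Im_Complex by (simp only: times_divide_times_eq diff_divide_distrib)
      \<comment> \<open>The three-term Pluecker relation for the area form.\<close>
      also have "Im (a * cnj x) * Im (y * cnj b) - Im (x * cnj b) * Im (a * cnj y) = - \<delta> * Im (x * cnj y)"
        by (simp add: \<delta>_def algebra_simps)
      finally show ?thesis using \<delta> by simp
    qed
    show "\<exists>u'\<in>?R. norm u' = 1 \<and> plane_conj A u e u'" if g: "(x, t, u, e) \<in> G" for x t u e
    proof (cases e)
      case False
      then have "u = 1 \<or> u = - 1" using rot g by auto
      then show ?thesis using R[of 1 0] R[of "-1" 0] False
        by (intro bexI[of _ u]) (auto simp: plane_conj_def cj_def Aneg)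
    next
      case True
      then have "(x, t, u, True) \<in> G" using g by simp
      from refl[OF this] obtain \<sigma> where
        \<sigma>: "\<sigma> = 1 \<or> \<sigma> = - 1" "u * cnj a = \<sigma> * a" "u * cnj b = - \<sigma> * b"
        by blast
      \<comment> \<open>Removing the sign gives a reflection that fixes \<open>a\<close> and negates
        \<open>b\<close>; since \<open>\<sigma>\<close> is its own inverse, \<open>u\<close> is
        recovered.\<close>
      define v where "v = \<sigma> * u"
      have u: "u = \<sigma> * v" using \<sigma>(1) by (auto simp: v_def)
      have v: "v * cnj a = a" "v * cnj b = - b" using \<sigma> by (auto simp: v_def)
      have Av: "A (v * cnj z) = cnj (A z)" for z
      proof -
        have "v * cnj z * cnj b = - cnj (z * cnj b)"
          using v(2) by (simp add: mult.assoc mult.left_commute[of v])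
        then have 1: "Im (v * cnj z * cnj b) = Im (z * cnj b)"
          by (simp only: uminus_complex.simps cnj.simps minus_minus)
        have "a * cnj (v * cnj z) = cnj (v * cnj a) * z"
          by (simp add: mult_ac)
        then have "a * cnj (v * cnj z) = cnj (a * cnj z)" by (simp only: v(1)) simp
        then have 2: "Im (a * cnj (v * cnj z)) = - Im (a * cnj z)" by (simp only: cnj.simps)
        show ?thesis unfolding A_def complex_cnj 1 2 minus_divide_left ..
      qed
      have "A (u * cnj z) = \<sigma> * cnj (A z)" for z
        using \<sigma>(1)
      proof
        assume "\<sigma> = 1"
        then show ?thesis by (simp only: u mult_1_left Av)
      next
        assume "\<sigma> = - 1"
        then show ?thesis by (simp only: u mult_minus_left mult_1_left Aneg Av)
      qed
      then have "plane_conj A u e \<sigma>" using True by (simp only: plane_conj_def cj_def if_True simp_thms)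
      moreover have "\<sigma> \<in> ?R" "norm \<sigma> = 1" using \<sigma>(1) R[of 1 0] R[of "-1" 0] by auto
      ultimately show ?thesis by (intro bexI[of _ \<sigma>] conjI)
    qed
  qed (use \<delta> R in auto)
qed

end

section \<open>Choice between the Gaussian and the Eisenstein field\<close>

theorem mainTheorem20:
  fixes \<Gamma> :: "nilisom set"
  assumes "closed_nil_group \<Gamma>"
  shows "\<exists>k \<in> {QQi, QQzeta3}. \<exists>\<phi>.
           \<phi> \<in> hom (NilIsom\<lparr>carrier := \<Gamma>\<rparr>) (NilIsom\<lparr>carrier := NilR (ring_of_integers k)\<rparr>)
         \<and> inj_on \<phi> \<Gamma>"
proof -
  have G: "subgroup \<Gamma> NilIsom" "discrete_set \<Gamma>" "cocompact \<Gamma>"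
    using assms by (auto simp: closed_nil_group_def)
  interpret nil_subgroup \<Gamma> by (rule nil_subgroup.intro[OF G(1)])
  have fields: "QQi = quad_field \<i>" "QQzeta3 = quad_field zeta3"
    by (simp_all add: QQi_def QQzeta3_def quad_field_def)
  have "\<exists>w\<in>{\<i>, zeta3}. nil_embeds \<Gamma> (ring_of_integers (quad_field w))"
  \<comment> \<open>A rotation other than 1 and -1 determines the field; if there is none, the
    Gaussian field serves.\<close>
  proof (cases "\<exists>x t u. (x, t, u, False) \<in> \<Gamma> \<and> u \<noteq> 1 \<and> u \<noteq> - 1")
    case True
    then obtain x t u where g: "(x, t, u, False) \<in> \<Gamma>" "u \<noteq> 1" "u \<noteq> - 1" by blast
    obtain w m n where w: "w \<in> {\<i>, zeta3}" "w = of_int m + of_int n * u"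
      using nontrivial_rotation_generates[OF unit[OF g(1)] crystallographic_restriction[OF G(2,3) g(1)] g(2,3)]
      by blast
    have "w * l \<in> transl" if "l \<in> transl" for l
      using transl_add[OF transl_int[OF that, of m] transl_int[OF transl_rot[OF g(1) that], of n]]
      by (simp add: w(2) cj_def algebra_simps)
    moreover have "\<i> * \<i> = of_int 0 * \<i> - 1" by simp
    then have "\<exists>k. w * w = of_int k * w - 1"
      using w(1) zeta3_quadratic by blast
    moreover have "Im w \<noteq> 0" using w(1) by (auto simp: zeta3_def)
    ultimately show ?thesis using nil_embeds_rotation[OF G(2,3)] w(1) by blast
  next
    case False
    then show ?thesis using nil_embeds_no_rotation[OF G(2,3)] by blast
  qed
  then show ?thesis unfolding nil_embeds_def fields by blast
qed

end
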